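(* Let $L_1,L_2\ge 1$ be integers and, for $\nu>0$, let $T_{-l_1,l_2}(\nu)$ be the first-passage time from state $-l_1$ to state $l_2$ of the birth-and-death process $(X_t)_{t\ge 0}$ on $\{-L_1,\dots,-1,0,1,\dots,L_2\}$ associated with the complete bipartite interference graph with component sizes $L_1,L_2$ and activation rate $\nu$. Then for any integers $0<l_1\le L_1$ and $0<l_2\le L_2$, $$\frac{T_{-l_1,l_2}(\nu)}{\mathbb{E}\,T_{-l_1,l_2}(\nu)}\xrightarrow{d}\mathrm{Exp}(1),\qquad \nu\to\infty .$$
   Context: The process $(X_t)_{t\ge0}$ (with parameter $\nu>0$) is the continuous-time Markov birth-and-death process on $\{-L_1,\dots,-1,0,1,\dots,L_2\}$ with transition rates $q(l,l+1)=|l|$ if $-L_1\le l<0$, $q(l,l+1)=(L_2-l)\nu$ if $0\le l<L_2$; $q(l,l-1)=(L_1-|l|)\nu$ if $-L_1<l\le 0$, $q(l,l-1)=l$ if $0<l\le L_2$. (A negative state $-l$ means that $l$ nodes of the first component are active; a positive state $l$ means that $l$ nodes of the second component are active.) For states $a\neq b$, $T_{a,b}(\nu)=\inf\{t>0: X_t=b\}$ given $X_0=a$. $\mathrm{Exp}(\lambda)$ denotes an exponentially distributed random variable with mean $1/\lambda$, and $\xrightarrow{d}$ denotes convergence in distribution. *)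

theory Defs
  imports "HOL-Probability.Probability"
begin

text \<open>Convergence of distribution functions along an arbitrary filter. The library notion
  \<open>weak_conv_m\<close> only covers sequences, whereas here a real parameter tends to infinity.\<close>

definition weak_conv_filter :: "('i \<Rightarrow> real measure) \<Rightarrow> real measure \<Rightarrow> 'i filter \<Rightarrow> bool" where
  "weak_conv_filter \<mu> \<mu>' F \<longleftrightarrow>
     (\<forall>x. isCont (cdf \<mu>') x \<longrightarrow> ((\<lambda>a. cdf (\<mu> a) x) \<longlongrightarrow> cdf \<mu>' x) F)"

lemma weak_conv_filter_sequentially:
  "weak_conv_filter \<mu> \<mu>' sequentially \<longleftrightarrow> weak_conv_m \<mu> \<mu>'"
  by (simp add: weak_conv_filter_def weak_conv_m_def weak_conv_def)

text \<open>Transition function of a continuous-time Markov chain on the finite set \<open>S\<close> whose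
  rate from \<open>i\<close> to \<open>j\<close> is \<open>q i j\<close>. Only off-diagonal rates are used: as \<open>S\<close> is finite and the
  rows sum to one, the behaviour of \<open>P h i i\<close> as \<open>h\<close> tends to \<open>0\<close> is determined by them.\<close>

definition transition_function ::
    "'s set \<Rightarrow> ('s \<Rightarrow> 's \<Rightarrow> real) \<Rightarrow> (real \<Rightarrow> 's \<Rightarrow> 's \<Rightarrow> real) \<Rightarrow> bool" where
  "transition_function S q P \<longleftrightarrow>
     (\<forall>t\<ge>0. \<forall>i\<in>S. \<forall>j\<in>S. P t i j \<ge> 0) \<and>
     (\<forall>t\<ge>0. \<forall>i\<in>S. (\<Sum>j\<in>S. P t i j) = 1) \<and>
     (\<forall>i\<in>S. \<forall>j\<in>S. P 0 i j = (if i = j then 1 else 0)) \<and>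
     (\<forall>s\<ge>0. \<forall>t\<ge>0. \<forall>i\<in>S. \<forall>j\<in>S. P (s + t) i j = (\<Sum>k\<in>S. P s i k * P t k j)) \<and>
     (\<forall>i\<in>S. \<forall>j\<in>S. i \<noteq> j \<longrightarrow> ((\<lambda>h. P h i j / h) \<longlongrightarrow> q i j) (at_right 0))"

definition past :: "'a measure \<Rightarrow> (real \<Rightarrow> 'a \<Rightarrow> 's) \<Rightarrow> real \<Rightarrow> 'a measure" where
  "past M X s = sigma (space M) {X u -` B \<inter> space M | u B. 0 \<le> u \<and> u \<le> s}"

text \<open>A time-homogeneous Markov process \<open>(X t)\<close>, \<open>t \<ge> 0\<close>, on the finite state space \<open>S\<close> with
  transition rates \<open>q\<close> and started in \<open>a\<close>. Paths are right-continuous for the discrete topology.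
  The Markov property is written in multiplied-out form, so that null events need no special
  treatment.\<close>

locale markov_chain = prob_space M
  for M :: "'a measure" and S :: "'s set" and q :: "'s \<Rightarrow> 's \<Rightarrow> real"
    and X :: "real \<Rightarrow> 'a \<Rightarrow> 's" and a :: 's +
  assumes finite_states: "finite S"
    and measurable_X: "\<And>t. t \<ge> 0 \<Longrightarrow> X t \<in> measurable M (count_space S)"
    and right_continuous:
      "\<And>t \<omega>. t \<ge> 0 \<Longrightarrow> \<omega> \<in> space M \<Longrightarrow> \<forall>\<^sub>F s in at_right t. X s \<omega> = X t \<omega>"
    and start: "AE \<omega> in M. X 0 \<omega> = a"
    and markov: "\<exists>P. transition_function S q P \<and>
      (\<forall>s\<ge>0. \<forall>t\<ge>0. \<forall>A\<in>sets (past M X s). \<forall>i\<in>S. \<forall>j\<in>S.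
         prob {\<omega>\<in>A. X s \<omega> = i \<and> X (s + t) \<omega> = j} = prob {\<omega>\<in>A. X s \<omega> = i} * P t i j)"

definition first_passage_time :: "(real \<Rightarrow> 'a \<Rightarrow> 's) \<Rightarrow> 's \<Rightarrow> 'a \<Rightarrow> ennreal" where
  "first_passage_time X b \<omega> = Inf {ennreal t | t. t > 0 \<and> X t \<omega> = b}"

definition bipartite_rate :: "int \<Rightarrow> int \<Rightarrow> real \<Rightarrow> int \<Rightarrow> int \<Rightarrow> real" where
  "bipartite_rate L\<^sub>1 L\<^sub>2 \<nu> l m =
     (if m = l + 1 then
        (if - L\<^sub>1 \<le> l \<and> l < 0 then of_int \<bar>l\<bar>
         else if 0 \<le> l \<and> l < L\<^sub>2 then of_int (L\<^sub>2 - l) * \<nu>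
         else 0)
      else if m = l - 1 then
        (if - L\<^sub>1 < l \<and> l \<le> 0 then of_int (L\<^sub>1 - \<bar>l\<bar>) * \<nu>
         else if 0 < l \<and> l \<le> L\<^sub>2 then of_int l
         else 0)
      else 0)"

definition Exp_distr :: "real \<Rightarrow> real measure" where
  "Exp_distr r = density lborel (exponential_density r)"

end

theory Submission
  imports Defs
begin

text \<open>For large \<open>\<nu>\<close> the negative part of the state space is a well in which the chain spends almost
  all of its time before it hits \<open>l\<^sub>2\<close>, and from every state of the well the mean time to reach
  \<open>l\<^sub>2\<close> is almost the same number \<open>m\<close>. Such a hitting time is nearly memoryless, and the proof
  turns this into inequalities between moments. With \<open>T\<close> the hitting time,
  \<open>S t = Pr (T > t)\<close> and \<open>R t = E (T - t)\<^sup>+ = \<integral>\<^sub>t\<^sup>\<infinity> S\<close>, the Markov property and \<open>E\<^sub>i T \<le> m\<close> for all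
  \<open>i\<close> give \<open>R \<le> m S\<close>, whence \<open>R t \<le> m exp (- t / m)\<close>. If in addition
  \<open>\<integral>\<^sub>0\<^sup>\<infinity> R = E T\<^sup>2 / 2\<close> is almost \<open>m\<^sup>2\<close>, then there is no room for \<open>R\<close> to stay below this bound, so
  \<open>R t\<close> is close to \<open>m exp (- t / m)\<close>, and so is \<open>S t\<close> to \<open>exp (- t / m)\<close>.

  The two moment bounds come from a pair of functions: the mean hitting time \<open>f\<close>, which solves
  \<open>Q f = - 1\<close> and is almost equal to \<open>m\<close> on the well, and a function \<open>h\<close> with
  \<open>Q h \<le> - 1\<close> off the well and \<open>Q h \<le> 0\<close> on it, which bounds the time spent off the well.
  For a birth-and-death chain \<open>f\<close> is a sum of mean times \<open>c k\<close> from \<open>k\<close> to \<open>k + 1\<close>, given by a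
  one-step recursion; that recursion already shows \<open>c (k - 1) \<le> (L\<^sub>1 / \<nu>) c k\<close> for \<open>k < 0\<close>, so
  the last step out of the well dominates.

  All of this is carried out for the chain sampled at the times \<open>k \<delta>\<close>, where it reduces to the
  facts \<open>lyapunov_moments\<close> and \<open>tail_sandwich\<close> about sequences of real numbers, and is then
  transferred to continuous time along dyadic \<open>\<delta>\<close> by right-continuity of the paths. A sampled path
  may miss a visit to \<open>l\<^sub>2\<close>, so it is killed on \<open>{l\<^sub>2..}\<close>; that both sets are hit at the same time
  is \<open>AE_no_skip\<close>. The resulting explicit error bounds are \<open>normalised_hit_cdf\<close>, and the potentials
  \<open>f\<close> and \<open>h\<close> are built in \<open>bipartite_metastable\<close>.\<close>

section \<open>Sequences that behave like a geometric tail\<close>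

text \<open>When all estimates hold up to the relative error \<open>\<epsilon>\<close>, the mean of \<open>T\<close> is at most \<open>m / (1 - \<epsilon>)\<close>,
  and this is a lower bound for \<open>E T\<^sup>2 / 2\<close> in units of \<open>(m / (1 - \<epsilon>))\<^sup>2\<close>. It tends to \<open>1\<close> as
  \<open>\<epsilon>\<close> tends to \<open>0\<close>.\<close>
definition moment_ratio :: "real \<Rightarrow> real" where
  "moment_ratio \<epsilon> = (1 - \<epsilon>)^3 / (1 + \<epsilon>) * ((1 - \<epsilon>)^2 / (1 + \<epsilon>) - \<epsilon>)"

lemma moment_ratio_le_1:
  assumes "0 < \<epsilon>" "\<epsilon> < 1"
  shows "moment_ratio \<epsilon> \<le> 1"
proof -
  have "(1 - \<epsilon>)^3 \<le> 1" "(1 - \<epsilon>)^2 \<le> 1" using assms by (auto intro!: power_le_one)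
  hence a: "(1 - \<epsilon>)^3 / (1 + \<epsilon>) \<le> 1" and b: "(1 - \<epsilon>)^2 / (1 + \<epsilon>) \<le> 1"
    using assms by (simp_all add: pos_divide_le_eq)
  have "(1 - \<epsilon>)^2 / (1 + \<epsilon>) - \<epsilon> \<le> 1" using b assms by linarith
  hence "moment_ratio \<epsilon> \<le> (1 - \<epsilon>)^3 / (1 + \<epsilon>) * 1"
    unfolding moment_ratio_def using assms by (intro mult_left_mono) auto
  thus ?thesis using a by simp
qed

text \<open>The discrete form of the moment argument: \<open>s\<close> is a survival function on the grid \<open>\<delta> \<nat>\<close> and
  \<open>r\<close> its integrated tail. From \<open>r \<le> m s\<close> one gets both \<open>r k \<le> m q\<^sup>k\<close> with \<open>q = 1 - \<delta> / m\<close>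
  and, by summation, \<open>\<delta> \<Sum>\<^sub>j\<^sub>\<ge>\<^sub>k r j \<le> m r k\<close>. Subtracting the upper bounds for
  \<open>r 0, \<dots>, r (k - 1)\<close> from the assumed lower bound for the total sum therefore gives a lower bound
  for \<open>r k\<close>. Bounds for \<open>s\<close> follow, from above because \<open>s\<close> is decreasing and
  \<open>l \<delta> s (k + l) \<le> r k - r (k + l)\<close>.\<close>
lemma tail_sandwich:
  fixes s :: "nat \<Rightarrow> real" and \<delta> m v :: real
  defines "r \<equiv> \<lambda>k. \<delta> * (\<Sum>j. s (j + k))"
  assumes \<delta>: "\<delta> > 0" and m: "m > 0" and s0: "s 0 = 1" and anti: "antimono s"
    and nonneg: "\<And>k. s k \<ge> 0" and summ: "summable s"
    and rs: "\<And>k. r k \<le> m * s k" and v: "v * m^2 \<le> \<delta> * (\<Sum>k. r k)"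
  shows "\<delta> \<le> m"
    and "(1 - \<delta> / m)^k - (1 - v) \<le> s k"
    and "l > 0 \<Longrightarrow> s (k + l) \<le> (1 - \<delta> / m)^k + m * (1 - v) / (real l * \<delta>)"
proof -
  define q where "q = 1 - \<delta> / m"
  have summ': "summable (\<lambda>j. s (j + k))" for k
    using summ by (rule summable_ignore_initial_segment)
  have r_nonneg: "r k \<ge> 0" for k
    unfolding r_def using \<delta> nonneg by (intro mult_nonneg_nonneg suminf_nonneg summ') auto
  have r_split: "r k = \<delta> * (\<Sum>j<n. s (j + k)) + r (k + n)" for k n
    unfolding r_def using suminf_split_initial_segment[OF summ'[of k], of n]
    by (simp add: algebra_simps)
  have r_Suc: "r k = \<delta> * s k + r (Suc k)" for k
    using r_split[of k 1] by simp
  show \<delta>m: "\<delta> \<le> m"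
    using r_Suc[of 0] r_nonneg[of 1] rs[of 0] s0 by simp
  have q0: "0 \<le> q" "q \<le> 1"
    using \<delta>m m \<delta> by (auto simp: q_def)
  have r_step: "r (Suc k) \<le> q * r k" for k
  proof -
    have "r k / m \<le> s k" using rs[of k] m by (simp add: field_simps)
    hence "\<delta> * (r k / m) \<le> \<delta> * s k" using \<delta> by (intro mult_left_mono) auto
    moreover have "q * r k = r k - \<delta> * (r k / m)" by (simp add: q_def algebra_simps)
    ultimately show ?thesis using r_Suc[of k] by linarith
  qed
  have r_le: "r k \<le> m * q^k" for k
  proof (induction k)
    case 0
    thus ?case using rs[of 0] s0 by simp
  next
    case (Suc k)
    have "q * r k \<le> q * (m * q^k)" using q0 Suc by (intro mult_left_mono) auto
    thus ?case using r_step[of k] by (simp add: algebra_simps)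
  qed
  have summ_r: "summable r"
    by (rule summable_comparison_test'[where g = "\<lambda>k. m * s k" and N = 0])
      (use summ rs r_nonneg in auto)
  define V where "V k = \<delta> * (\<Sum>j. r (j + k))" for k
  have summ_r': "summable (\<lambda>j. r (j + k))" for k
    using summ_r by (rule summable_ignore_initial_segment)
  have V_le: "V k \<le> m * r k" for k
  proof -
    have "(\<Sum>j. r (j + k)) \<le> (\<Sum>j. m * s (j + k))"
      using rs by (intro suminf_le summ_r' summable_mult summ')
    also have "\<dots> = m * (\<Sum>j. s (j + k))" by (rule suminf_mult[OF summ'])
    finally show ?thesis using \<delta> by (simp add: V_def r_def algebra_simps)
  qed
  have geo: "\<delta> * (\<Sum>j<k. q^j) = m * (1 - q^k)" for k
    using m one_diff_power_eq[of q k] by (simp add: q_def field_simps)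
  have V_ge: "m^2 * (v - (1 - q^k)) \<le> V k" for k
  proof -
    have "(\<Sum>j<k. r j) \<le> (\<Sum>j<k. m * q^j)" by (intro sum_mono r_le)
    also have "\<dots> = m * (\<Sum>j<k. q^j)" by (rule sum_distrib_left [symmetric])
    finally have "\<delta> * (\<Sum>j<k. r j) \<le> \<delta> * (m * (\<Sum>j<k. q^j))"
      using \<delta> by (intro mult_left_mono) auto
    also have "\<dots> = m^2 * (1 - q^k)"
      using geo[of k] by (metis mult.left_commute power2_eq_square mult.assoc)
    finally have "\<delta> * (\<Sum>j<k. r j) \<le> m^2 * (1 - q^k)" .
    moreover have "V 0 = \<delta> * (\<Sum>j<k. r j) + V k"
      unfolding V_def using suminf_split_initial_segment[OF summ_r, of k]
      by (simp add: algebra_simps)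
    moreover have "V 0 = \<delta> * (\<Sum>k. r k)" by (simp add: V_def)
    ultimately show ?thesis using v by (simp add: algebra_simps)
  qed
  have r_ge: "m * (q^k - (1 - v)) \<le> r k" for k
  proof -
    have "m * (m * (q^k - (1 - v))) \<le> m * r k"
      using order_trans[OF V_ge V_le, of k] by (simp add: power2_eq_square algebra_simps)
    thus ?thesis using m by simp
  qed
  have "m * (q^k - (1 - v)) \<le> m * s k" using r_ge[of k] rs[of k] by linarith
  thus "(1 - \<delta> / m)^k - (1 - v) \<le> s k" using m by (simp add: q_def)
  show "s (k + l) \<le> (1 - \<delta> / m)^k + m * (1 - v) / (real l * \<delta>)" if l: "l > 0"
  proof -
    have "real l * s (k + l) = (\<Sum>j<l. s (k + l))" by simp
    also have "\<dots> \<le> (\<Sum>j<l. s (j + k))"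
      by (intro sum_mono antimonoD[OF anti]) auto
    finally have "real l * \<delta> * s (k + l) \<le> r k - r (k + l)"
      using r_split[of k l] \<delta> by (simp add: mult.assoc mult.left_commute)
    also have "\<dots> \<le> m * q^k - m * (q^(k + l) - (1 - v))"
      using r_le[of k] r_ge[of "k + l"] by linarith
    also have "\<dots> = m * (q^k * (1 - q^l)) + m * (1 - v)"
      by (simp add: power_add algebra_simps)
    also have "\<dots> \<le> m * (q^k * (real l * (\<delta> / m))) + m * (1 - v)"
    proof -
      have "1 - q^l \<le> real l * (\<delta> / m)"
        using Bernoulli_inequality[of "- \<delta> / m" l] \<delta>m m by (simp add: q_def field_simps)
      thus ?thesis using m q0 by (intro add_right_mono mult_left_mono) auto
    qed
    also have "\<dots> = real l * \<delta> * (q^k + m * (1 - v) / (real l * \<delta>))"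
      using m l \<delta> by (simp add: field_simps)
    finally show ?thesis using l \<delta> by (simp add: q_def)
  qed
qed

lemma exp_le_one_minus_power:
  fixes \<delta> m :: real
  assumes "0 \<le> \<delta>" "\<delta> < m"
  shows "exp (- (real k * \<delta>) / (m - \<delta>)) \<le> (1 - \<delta> / m)^k"
proof -
  define y where "y = \<delta> / (m - \<delta>)"
  have "0 \<le> y" using assms by (simp add: y_def)
  hence "exp (- y) \<le> inverse (1 + y)"
    using exp_ge_add_one_self[of y] by (simp add: exp_minus)
  also have "inverse (1 + y) = 1 - \<delta> / m"
    using assms by (simp add: y_def field_simps)
  finally have "exp (- y)^k \<le> (1 - \<delta> / m)^k" by (intro power_mono) auto
  also have "exp (- y)^k = exp (- (real k * \<delta>) / (m - \<delta>))"
    by (simp add: exp_of_nat_mult [symmetric] y_def)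
  finally show ?thesis .
qed

lemma one_minus_power_le_exp:
  fixes \<delta> m :: real
  assumes "0 < m" "\<delta> \<le> m"
  shows "(1 - \<delta> / m)^k \<le> exp (- (real k * \<delta>) / m)"
proof -
  have "(1 - \<delta> / m)^k \<le> exp (- \<delta> / m)^k"
    using assms exp_ge_add_one_self[of "- \<delta> / m"] by (intro power_mono) auto
  also have "\<dots> = exp (- (real k * \<delta>) / m)"
    by (simp add: exp_of_nat_mult [symmetric])
  finally show ?thesis .
qed

text \<open>Here \<open>s k\<close> is the probability of being alive at step \<open>k\<close>, \<open>z k\<close> that of being alive and off the
  well, and \<open>F k\<close>, \<open>H k\<close> are the expectations of \<open>f\<close> and \<open>h\<close> over the living paths. The drift of
  \<open>F\<close> makes \<open>F k\<close> comparable to the integrated tail \<open>r k\<close>, so \<open>F \<le> m s\<close> bounds \<open>r\<close> from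
  above and \<open>F \<ge> (1 - \<epsilon>) m (s - z)\<close> bounds the sum of \<open>r\<close> from below; the drift of \<open>H\<close> shows that
  the sum of \<open>z\<close> is negligible.\<close>
lemma lyapunov_moments:
  fixes s z F H :: "nat \<Rightarrow> real" and \<delta> \<epsilon> m :: real
  defines "r \<equiv> \<lambda>k. \<delta> * (\<Sum>j. s (j + k))"
  assumes \<delta>: "\<delta> > 0" and \<epsilon>: "0 < \<epsilon>" "\<epsilon> < 1" and m: "m > 0"
    and s: "\<And>k. s k \<ge> 0" and z: "\<And>k. z k \<ge> 0"
    and F: "\<And>k. F k \<ge> 0" "\<And>k. F k \<le> m * s k"
    and Fz: "\<And>k. (1 - \<epsilon>) * m * (s k - z k) \<le> F k"
    and F_step: "\<And>k. \<delta> * (1 - \<epsilon>) * s k \<le> F k - F (Suc k)"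
                "\<And>k. F k - F (Suc k) \<le> \<delta> * (1 + \<epsilon>) * s k"
    and H: "\<And>k. H k \<ge> 0"
    and H_step: "\<And>k. \<delta> * (z k - \<epsilon> * s k) \<le> H k - H (Suc k)"
    and F0: "(1 - \<epsilon>) * m \<le> F 0" and H0: "H 0 \<le> \<epsilon> * m"
  shows "summable s" and "r k \<le> m / (1 - \<epsilon>) * s k"
    and "(1 - \<epsilon>) / (1 + \<epsilon>) * m \<le> r 0"
    and "moment_ratio \<epsilon> * (m / (1 - \<epsilon>))^2 \<le> \<delta> * (\<Sum>k. r k)"
proof -
  have part: "\<delta> * (1 - \<epsilon>) * (\<Sum>j<n. s (j + k)) \<le> F k - F (k + n)" for k n
  proof (induction n)
    case (Suc n)
    thus ?case using F_step(1)[of "n + k"] by (simp add: algebra_simps)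
  qed simp
  have part2: "F k - F (k + n) \<le> \<delta> * (1 + \<epsilon>) * (\<Sum>j<n. s (j + k))" for k n
  proof (induction n)
    case (Suc n)
    thus ?case using F_step(2)[of "n + k"] by (simp add: algebra_simps)
  qed simp
  have pos: "\<delta> * (1 - \<epsilon>) > 0" using \<delta> \<epsilon> by simp
  have part_le: "(\<Sum>j<n. s (j + k)) \<le> m * s k / (\<delta> * (1 - \<epsilon>))" for k n
  proof -
    have "\<delta> * (1 - \<epsilon>) * (\<Sum>j<n. s (j + k)) \<le> m * s k"
      using part[where n = n and k = k] F(1)[of "k + n"] F(2)[of k] by linarith
    thus ?thesis using pos by (simp add: pos_le_divide_eq mult.commute)
  qed
  show summ: "summable s"
    by (rule summableI_nonneg_bounded[of _ "m * s 0 / (\<delta> * (1 - \<epsilon>))"])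
      (use s part_le[where k = 0] in auto)
  have summ': "summable (\<lambda>j. s (j + k))" for k
    using summ by (rule summable_ignore_initial_segment)
  have rs: "r k \<le> m / (1 - \<epsilon>) * s k" for k
  proof -
    have "(\<Sum>j. s (j + k)) \<le> m * s k / (\<delta> * (1 - \<epsilon>))"
      using part_le by (intro suminf_le_const summ')
    hence "r k \<le> \<delta> * (m * s k / (\<delta> * (1 - \<epsilon>)))"
      unfolding r_def using \<delta> by (intro mult_left_mono) auto
    thus ?thesis using \<delta> by simp
  qed
  thus "r k \<le> m / (1 - \<epsilon>) * s k" .
  have Fr: "F k \<le> (1 + \<epsilon>) * r k" for k
  proof -
    have "(\<lambda>n. s (n + k)) \<longlonglongrightarrow> 0" using summ' by (rule summable_LIMSEQ_zero)
    hence lim: "(\<lambda>n. m * s (n + k) + (1 + \<epsilon>) * r k) \<longlonglongrightarrow> m * 0 + (1 + \<epsilon>) * r k"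
      by (intro tendsto_intros)
    have "F k \<le> m * s (n + k) + (1 + \<epsilon>) * r k" for n
    proof -
      have "(\<Sum>j<n. s (j + k)) \<le> (\<Sum>j. s (j + k))"
        using s by (intro sum_le_suminf summ') auto
      hence "\<delta> * (1 + \<epsilon>) * (\<Sum>j<n. s (j + k)) \<le> \<delta> * (1 + \<epsilon>) * (\<Sum>j. s (j + k))"
        using \<delta> \<epsilon> by (intro mult_left_mono) auto
      hence "\<delta> * (1 + \<epsilon>) * (\<Sum>j<n. s (j + k)) \<le> (1 + \<epsilon>) * r k"
        by (simp add: r_def mult.assoc mult.left_commute)
      thus ?thesis using part2[where k = k and n = n] F(2)[of "k + n"] by (simp add: add.commute)
    qed
    hence "F k \<le> m * 0 + (1 + \<epsilon>) * r k"
      by (intro LIMSEQ_le_const[OF lim]) auto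
    thus ?thesis by simp
  qed
  show r0: "(1 - \<epsilon>) / (1 + \<epsilon>) * m \<le> r 0"
    using Fr[of 0] F0 \<epsilon> by (simp add: field_simps)
  have H_part: "\<delta> * (\<Sum>j<n. z j) \<le> H 0 - H n + \<epsilon> * (\<delta> * (\<Sum>j<n. s j))" for n
  proof (induction n)
    case (Suc n)
    thus ?case using H_step[of n] by (simp add: algebra_simps)
  qed simp
  have z_part: "(\<Sum>j<n. z j) \<le> (\<epsilon> * m + \<epsilon> * r 0) / \<delta>" for n
  proof -
    have "(\<Sum>j<n. s j) \<le> (\<Sum>j. s j)" using s by (intro sum_le_suminf summ) auto
    hence "\<epsilon> * (\<delta> * (\<Sum>j<n. s j)) \<le> \<epsilon> * r 0" using \<delta> \<epsilon> by (simp add: r_def)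
    hence "\<delta> * (\<Sum>j<n. z j) \<le> \<epsilon> * m + \<epsilon> * r 0" using H_part[of n] H[of n] H0 by linarith
    thus ?thesis using \<delta> by (simp add: field_simps)
  qed
  have summ_z: "summable z" by (rule summableI_nonneg_bounded[OF z z_part])
  have "(\<Sum>j. z j) \<le> (\<epsilon> * m + \<epsilon> * r 0) / \<delta>"
    by (intro suminf_le_const summ_z z_part)
  hence z_sum: "\<delta> * (\<Sum>j. z j) \<le> \<epsilon> * m + \<epsilon> * r 0" using \<delta> by (simp add: field_simps)
  define c where "c = (1 - \<epsilon>) / (1 + \<epsilon>)"
  have c: "c > 0" using \<epsilon> by (simp add: c_def)
  have r_ge: "c * m * (s k - z k) \<le> r k" for k
    using order_trans[OF Fz Fr, of k] \<epsilon> by (simp add: c_def field_simps)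
  have r_nonneg: "r k \<ge> 0" for k
    using \<delta> s by (auto simp: r_def intro!: mult_nonneg_nonneg suminf_nonneg summ')
  have summ_r: "summable r"
    by (rule summable_comparison_test'[where g = "\<lambda>k. m / (1 - \<epsilon>) * s k" and N = 0])
      (use summ rs r_nonneg in \<open>auto intro!: summable_mult\<close>)
  have summ_sz: "summable (\<lambda>k. s k - z k)" using summ summ_z by (rule summable_diff)
  have "c * m * (\<Sum>k. s k - z k) \<le> (\<Sum>k. r k)"
    unfolding suminf_mult[OF summ_sz, symmetric]
    by (intro suminf_le summable_mult summ_sz summ_r r_ge)
  hence "\<delta> * (c * m * ((\<Sum>k. s k) - (\<Sum>k. z k))) \<le> \<delta> * (\<Sum>k. r k)"
    using \<delta> by (simp add: suminf_diff[OF summ summ_z])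
  moreover have "\<delta> * (c * m * ((\<Sum>k. s k) - (\<Sum>k. z k))) = c * m * (r 0 - \<delta> * (\<Sum>k. z k))"
    by (simp add: r_def algebra_simps)
  moreover have "c * m * ((1 - \<epsilon>) * (c * m) - \<epsilon> * m) \<le> c * m * (r 0 - \<delta> * (\<Sum>k. z k))"
  proof -
    have "(1 - \<epsilon>) * (c * m) \<le> (1 - \<epsilon>) * r 0"
      using r0 \<epsilon> by (intro mult_left_mono) (auto simp: c_def)
    hence "(1 - \<epsilon>) * (c * m) - \<epsilon> * m \<le> r 0 - \<delta> * (\<Sum>k. z k)"
      using z_sum by (simp add: algebra_simps)
    thus ?thesis using c m by (intro mult_left_mono) auto
  qed
  moreover have "moment_ratio \<epsilon> * (m / (1 - \<epsilon>))^2 = c * m * ((1 - \<epsilon>) * (c * m) - \<epsilon> * m)"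
  proof -
    have "moment_ratio \<epsilon> * (m / (1 - \<epsilon>))^2
        = (1 - \<epsilon>) / (1 + \<epsilon>) * ((1 - \<epsilon>)^2 / (1 + \<epsilon>) - \<epsilon>) * m^2"
      using \<epsilon> by (simp add: moment_ratio_def power_divide power2_eq_square power3_eq_cube)
    thus ?thesis by (simp add: c_def power2_eq_square algebra_simps)
  qed
  ultimately show "moment_ratio \<epsilon> * (m / (1 - \<epsilon>))^2 \<le> \<delta> * (\<Sum>k. r k)" by linarith
qed

section \<open>Hitting times of right-continuous paths\<close>
definition hit :: "(real \<Rightarrow> 's) \<Rightarrow> 's set \<Rightarrow> ennreal" where
  "hit x B = Inf {ennreal t | t. t > 0 \<and> x t \<in> B}"

definition grid_hit :: "(real \<Rightarrow> 's) \<Rightarrow> 's set \<Rightarrow> real \<Rightarrow> ennreal" where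
  "grid_hit x B \<delta> = Inf {ennreal (real j * \<delta>) | j. j \<ge> 1 \<and> x (real j * \<delta>) \<in> B}"

lemma first_passage_time_eq_hit: "first_passage_time X b \<omega> = hit (\<lambda>t. X t \<omega>) {b}"
  by (simp add: first_passage_time_def hit_def)

lemma hit_le_grid_hit: "\<delta> > 0 \<Longrightarrow> hit x B \<le> grid_hit x B \<delta>"
  unfolding hit_def grid_hit_def by (intro Inf_superset_mono) force

text \<open>Halving the mesh only adds grid points; this makes the dyadic approximations monotone.\<close>
lemma grid_hit_halve:
  assumes "\<delta> > 0" shows "grid_hit x B (\<delta> / 2) \<le> grid_hit x B \<delta>"
  unfolding grid_hit_def
proof (intro Inf_superset_mono subsetI)
  fix y assume "y \<in> {ennreal (real j * \<delta>) |j. 1 \<le> j \<and> x (real j * \<delta>) \<in> B}"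
  then obtain j where j: "y = ennreal (real j * \<delta>)" "1 \<le> j" "x (real j * \<delta>) \<in> B" by auto
  have "real (2 * j) * (\<delta> / 2) = real j * \<delta>" by simp
  with j show "y \<in> {ennreal (real j * (\<delta> / 2)) |j. 1 \<le> j \<and> x (real j * (\<delta> / 2)) \<in> B}"
    by (intro CollectI exI[of _ "2 * j"]) (metis mult_2 trans_le_add1)
qed

text \<open>Layer-cake form of the sampled hitting time, through which its mean becomes a sum of survival
  probabilities.\<close>
lemma grid_hit_eq_suminf:
  assumes \<delta>: "\<delta> > 0"
  shows "grid_hit x B \<delta> = (\<Sum>k. ennreal \<delta> * of_bool (\<forall>j\<in>{1..k}. x (real j * \<delta>) \<notin> B))"
proof (cases "\<exists>j\<ge>1. x (real j * \<delta>) \<in> B")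
  case False
  have "\<not> (\<Sum>k. ennreal \<delta>) < top"
  proof
    assume "(\<Sum>k::nat. ennreal \<delta>) < top"
    hence "summable (\<lambda>k::nat. \<delta>)"
      using \<delta> by (intro summable_suminf_not_top) auto
    hence "(\<lambda>k::nat. \<delta>) \<longlonglongrightarrow> 0" by (rule summable_LIMSEQ_zero)
    thus False using \<delta> by (simp add: LIMSEQ_const_iff)
  qed
  hence "(\<Sum>k::nat. ennreal \<delta>) = top" by (metis less_top)
  moreover have "grid_hit x B \<delta> = Inf {}"
    unfolding grid_hit_def using False by (intro arg_cong[where f = Inf]) auto
  moreover have "(\<lambda>k. ennreal \<delta> * of_bool (\<forall>j\<in>{1..k}. x (real j * \<delta>) \<notin> B)) = (\<lambda>k::nat. ennreal \<delta>)"
    using False by (intro ext) auto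
  ultimately show ?thesis by (simp only: Inf_empty)
next
  case True
  define j0 where "j0 = (LEAST j. j \<ge> 1 \<and> x (real j * \<delta>) \<in> B)"
  have j0: "j0 \<ge> 1" "x (real j0 * \<delta>) \<in> B"
    using LeastI_ex[of "\<lambda>j. j \<ge> 1 \<and> x (real j * \<delta>) \<in> B"] True by (auto simp: j0_def)
  have least: "j0 \<le> j" if "j \<ge> 1" "x (real j * \<delta>) \<in> B" for j
    unfolding j0_def by (rule Least_le) (use that in auto)
  have "grid_hit x B \<delta> = ennreal (real j0 * \<delta>)"
    unfolding grid_hit_def
  proof (rule antisym)
    show "Inf {ennreal (real j * \<delta>) |j. 1 \<le> j \<and> x (real j * \<delta>) \<in> B} \<le> ennreal (real j0 * \<delta>)"
      by (rule Inf_lower) (use j0 in auto)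
    show "ennreal (real j0 * \<delta>) \<le> Inf {ennreal (real j * \<delta>) |j. 1 \<le> j \<and> x (real j * \<delta>) \<in> B}"
      by (rule Inf_greatest) (use least \<delta> in \<open>auto intro!: ennreal_leI mult_right_mono\<close>)
  qed
  also have "\<dots> = (\<Sum>k<j0. ennreal \<delta>)"
    using \<delta> by (simp add: ennreal_mult ennreal_of_nat_eq_real_of_nat)
  also have "\<dots> = (\<Sum>k<j0. ennreal \<delta> * of_bool (\<forall>j\<in>{1..k}. x (real j * \<delta>) \<notin> B))"
    using least by (intro sum.cong refl) fastforce
  also have "\<dots> = (\<Sum>k. ennreal \<delta> * of_bool (\<forall>j\<in>{1..k}. x (real j * \<delta>) \<notin> B))"
    using j0 by (intro suminf_finite [symmetric]) (auto simp: not_less)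
  finally show ?thesis .
qed

lemma ex_grid_point:
  fixes \<delta> s :: real
  assumes "\<delta> > 0" "s > 0"
  obtains j :: nat where "j \<ge> 1" "s \<le> real j * \<delta>" "real (j - 1) * \<delta> < s"
proof
  define j where "j = nat \<lceil>s / \<delta>\<rceil>"
  have pos: "s / \<delta> > 0" using assms by simp
  have ge: "s / \<delta> \<le> real j" unfolding j_def by (rule real_nat_ceiling_ge)
  with pos have j1: "j \<ge> 1" by (cases j) auto
  have "real j < s / \<delta> + 1" unfolding j_def using pos by linarith
  hence lt: "real (j - 1) < s / \<delta>" using j1 by simp
  show "j \<ge> 1" "s \<le> real j * \<delta>" "real (j - 1) * \<delta> < s"
    using ge lt j1 assms by (simp_all add: field_simps)
qed

context
  fixes x :: "real \<Rightarrow> 's"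
  assumes rc: "\<And>t. t \<ge> 0 \<Longrightarrow> \<forall>\<^sub>F s in at_right t. x s = x t"
begin

lemma constant_right:
  assumes "t \<ge> 0"
  obtains \<eta> where "\<eta> > 0" "\<And>s. t \<le> s \<Longrightarrow> s < t + \<eta> \<Longrightarrow> x s = x t"
proof -
  obtain b where b: "b > t" "\<And>s. s > t \<Longrightarrow> s < b \<Longrightarrow> x s = x t"
    using rc[OF assms] unfolding eventually_at_right_field by blast
  show thesis
  proof (rule that[of "b - t"])
    show "x s = x t" if "t \<le> s" "s < t + (b - t)" for s
      using b(2)[of s] that by (cases "s = t") auto
  qed (use b in auto)
qed

text \<open>Right-continuity makes the path constant for a while after \<open>s\<close>, so every visit is seen by all
  sufficiently fine grids, at the first grid point after \<open>s\<close>.\<close>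
lemma eventually_grid_point_near:
  assumes s: "s > 0" and c: "s < c" and \<tau>: "\<tau> > 0"
  shows "\<forall>\<^sub>F n in sequentially. \<exists>j\<ge>1. x (real j * (\<tau> / 2^n)) = x s \<and>
           s \<le> real j * (\<tau> / 2^n) \<and> real j * (\<tau> / 2^n) < c \<and> real (j - 1) * (\<tau> / 2^n) < s"
proof -
  obtain \<eta> where \<eta>: "\<eta> > 0" "\<And>u. s \<le> u \<Longrightarrow> u < s + \<eta> \<Longrightarrow> x u = x s"
    using constant_right[OF less_imp_le[OF s]] by blast
  have "(\<lambda>n. \<tau> / 2^n) \<longlonglongrightarrow> 0" by (rule LIMSEQ_divide_realpow_zero) simp
  hence "\<forall>\<^sub>F n in sequentially. \<tau> / 2^n < min \<eta> (c - s)"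
    using \<eta> c by (intro order_tendstoD) auto
  thus ?thesis
  proof eventually_elim
    case (elim n)
    obtain j where j: "j \<ge> 1" "s \<le> real j * (\<tau> / 2^n)" "real (j - 1) * (\<tau> / 2^n) < s"
      using ex_grid_point[of "\<tau> / 2^n" s] s \<tau> by auto
    have "real j * (\<tau> / 2^n) = real (j - 1) * (\<tau> / 2^n) + \<tau> / 2^n"
      using j(1) by (simp add: of_nat_diff add_divide_distrib [symmetric] algebra_simps)
    hence "real j * (\<tau> / 2^n) < s + min \<eta> (c - s)" using elim j(3) by linarith
    thus ?case using j \<eta>(2)[of "real j * (\<tau> / 2^n)"] by (intro exI[of _ j]) auto
  qed
qed

text \<open>The infimum over hitting times is attained by right-continuity, hence the closed interval on the
  right-hand side.\<close>
lemma less_hit_iff: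
  assumes t: "t > 0"
  shows "ennreal t < hit x B \<longleftrightarrow> (\<forall>s\<in>{0<..t}. x s \<notin> B)"
proof
  assume *: "ennreal t < hit x B"
  show "\<forall>s\<in>{0<..t}. x s \<notin> B"
  proof (intro ballI notI)
    fix s assume s: "s \<in> {0<..t}" "x s \<in> B"
    have "hit x B \<le> ennreal s" unfolding hit_def by (rule Inf_lower) (use s in auto)
    also have "ennreal s \<le> ennreal t" using s by (intro ennreal_leI) auto
    finally show False using * by simp
  qed
next
  assume *: "\<forall>s\<in>{0<..t}. x s \<notin> B"
  obtain \<eta> where \<eta>: "\<eta> > 0" "\<And>s. t \<le> s \<Longrightarrow> s < t + \<eta> \<Longrightarrow> x s = x t"
    using constant_right[OF less_imp_le[OF t]] by blast
  have "ennreal t < ennreal (t + \<eta>)" using t \<eta> by (simp add: ennreal_less_iff)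
  also have "ennreal (t + \<eta>) \<le> hit x B"
    unfolding hit_def
  proof (rule Inf_greatest)
    fix y assume "y \<in> {ennreal t |t. 0 < t \<and> x t \<in> B}"
    then obtain s where s: "y = ennreal s" "0 < s" "x s \<in> B" by auto
    have "\<not> s \<le> t" using * s(2,3) by force
    moreover have "x t \<notin> B" using * t by simp
    hence "\<not> (t \<le> s \<and> s < t + \<eta>)" using \<eta>(2) s(3) by metis
    ultimately have "t + \<eta> \<le> s" by linarith
    thus "ennreal (t + \<eta>) \<le> y" using s by (auto intro: ennreal_leI)
  qed
  finally show "ennreal t < hit x B" .
qed

lemma hit_pos:
  assumes x0: "x 0 \<notin> B"
  shows "0 < hit x B"
proof -
  obtain \<eta> where \<eta>: "\<eta> > 0" "\<And>s. 0 \<le> s \<Longrightarrow> s < 0 + \<eta> \<Longrightarrow> x s = x 0"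
    using constant_right[OF order_refl] by blast
  have "x u \<notin> B" if "u \<in> {0<..\<eta>/2}" for u
    using \<eta>(1) \<eta>(2)[of u] x0 that by simp
  hence "ennreal (\<eta>/2) < hit x B" using less_hit_iff[of "\<eta>/2" B] \<eta>(1) by simp
  thus ?thesis by (rule le_less_trans[rotated]) simp
qed

lemma less_hit_iff_grid:
  assumes \<tau>: "\<tau> > 0" and p: "p > 0"
  shows "ennreal (real p * \<tau>) < hit x B \<longleftrightarrow>
    (\<forall>n. \<forall>j\<in>{1..p * 2^n}. x (real j * (\<tau> / 2^n)) \<notin> B)"
proof -
  have pos: "real p * \<tau> > 0" using assms by simp
  show ?thesis unfolding less_hit_iff[OF pos]
  proof safe
    fix n j assume *: "\<forall>s\<in>{0<..real p * \<tau>}. x s \<notin> B" and j: "j \<in> {1..p * 2^n}"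
      and "x (real j * (\<tau> / 2^n)) \<in> B"
    moreover have "real j * (\<tau> / 2^n) \<le> real (p * 2^n) * (\<tau> / 2^n)"
      using j \<tau> by (intro mult_right_mono) (simp_all only: of_nat_le_iff atLeastAtMost_iff, auto)
    hence "real j * (\<tau> / 2^n) \<le> real p * \<tau>" by simp
    ultimately show False using \<tau> j by auto
  next
    fix s assume *: "\<forall>n. \<forall>j\<in>{1..p * 2^n}. x (real j * (\<tau> / 2^n)) \<notin> B"
      and s: "s \<in> {0<..real p * \<tau>}" "x s \<in> B"
    show False
    proof (cases "s = real p * \<tau>")
      case True
      thus ?thesis using *[rule_format, of p 0] p s by auto
    next
      case False
      hence "\<forall>\<^sub>F n in sequentially. \<exists>j\<ge>1. x (real j * (\<tau> / 2^n)) = x s \<and>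
           s \<le> real j * (\<tau> / 2^n) \<and> real j * (\<tau> / 2^n) < real p * \<tau> \<and> real (j - 1) * (\<tau> / 2^n) < s"
        using s \<tau> by (intro eventually_grid_point_near) auto
      then obtain n j where nj: "j \<ge> 1" "x (real j * (\<tau> / 2^n)) = x s" "real j * (\<tau> / 2^n) < real p * \<tau>"
        by (auto dest: eventually_happens)
      have "real j < real p * 2^n" using nj(3) \<tau> by (simp add: field_simps)
      hence "real j < real (p * 2^n)" by simp
      hence "j \<le> p * 2^n" unfolding of_nat_less_iff by simp
      thus False using *[rule_format, of j n] nj(1,2) s(2) by simp
    qed
  qed
qed

lemma hit_eq_INF_grid_hit:
  assumes \<tau>: "\<tau> > 0"
  shows "hit x B = (INF n. grid_hit x B (\<tau> / 2^n))"
proof (rule antisym)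
  show "hit x B \<le> (INF n. grid_hit x B (\<tau> / 2^n))"
    using \<tau> by (intro INF_greatest hit_le_grid_hit) auto
  show "(INF n. grid_hit x B (\<tau> / 2^n)) \<le> hit x B"
    unfolding hit_def
  proof (rule Inf_greatest)
    fix y assume "y \<in> {ennreal t |t. 0 < t \<and> x t \<in> B}"
    then obtain s where s: "y = ennreal s" "0 < s" "x s \<in> B" by auto
    have "(INF n. grid_hit x B (\<tau> / 2^n)) \<le> ennreal s + ennreal e" if e: "e > 0" for e
    proof -
      obtain n j where nj: "j \<ge> 1" "x (real j * (\<tau> / 2^n)) = x s" "real j * (\<tau> / 2^n) < s + e"
        using eventually_grid_point_near[of s "s + e" \<tau>] s e \<tau> by (auto dest: eventually_happens)
      have "(INF n. grid_hit x B (\<tau> / 2^n)) \<le> grid_hit x B (\<tau> / 2^n)" by (rule INF_lower) auto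
      also have "\<dots> \<le> ennreal (real j * (\<tau> / 2^n))"
        unfolding grid_hit_def by (rule Inf_lower) (use nj s in auto)
      also have "\<dots> \<le> ennreal (s + e)" using nj by (intro ennreal_leI) auto
      finally show ?thesis using s e by simp
    qed
    thus "(INF n. grid_hit x B (\<tau> / 2^n)) \<le> y"
      unfolding s(1) by (rule ennreal_le_epsilon)
  qed
qed

text \<open>If the path enters \<open>B\<close> strictly before it enters \<open>C\<close>, then the state in which it enters \<open>B\<close>
  lies outside \<open>C\<close> and is held for a while, so every fine grid sees a direct step from outside \<open>B\<close>
  to \<open>B - C\<close>.\<close>
lemma hit_subset_or_grid_skip:
  assumes C: "C \<subseteq> B" and x0: "x 0 \<notin> B" and \<tau>: "\<tau> > 0"
    and lt: "hit x B < hit x C"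
  shows "\<exists>p::nat. \<forall>\<^sub>F n in sequentially. \<exists>k<p * 2^n.
           x (real k * (\<tau> / 2^n)) \<notin> B \<and> x (real (Suc k) * (\<tau> / 2^n)) \<in> B - C"
proof -
  define s where "s = enn2real (hit x B)"
  have "hit x B < top" using lt by (rule less_le_trans) simp
  hence hs: "hit x B = ennreal s" by (simp add: s_def)
  have s0: "s \<ge> 0" by (simp add: s_def)
  have before: "x u \<notin> B" if "0 < u" "u < s" for u
  proof
    assume "x u \<in> B"
    hence "hit x B \<le> ennreal u" unfolding hit_def using that by (intro Inf_lower) auto
    thus False using hs that by (simp add: ennreal_le_iff)
  qed
  have spos: "s > 0" using hit_pos[of B] x0 hs s0 by (cases "s = 0") auto
  have xs: "x s \<in> B"
  proof (rule ccontr)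
    assume "x s \<notin> B"
    hence "\<forall>u\<in>{0<..s}. x u \<notin> B" using before by (metis greaterThanAtMost_iff less_eq_real_def)
    hence "ennreal s < hit x B" by (simp only: less_hit_iff[OF spos])
    thus False using hs by simp
  qed
  have xs': "x s \<notin> C"
  proof
    assume "x s \<in> C"
    hence "hit x C \<le> ennreal s" unfolding hit_def using spos by (intro Inf_lower) auto
    thus False using lt hs by simp
  qed
  obtain p :: nat where p: "s + 1 \<le> real p * \<tau>"
    using real_arch_simple[of "(s + 1) / \<tau>"] \<tau> by (auto simp: field_simps)
  have "\<forall>\<^sub>F n in sequentially. \<exists>j\<ge>1. x (real j * (\<tau> / 2^n)) = x s \<and>
           s \<le> real j * (\<tau> / 2^n) \<and> real j * (\<tau> / 2^n) < s + 1 \<and> real (j - 1) * (\<tau> / 2^n) < s"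
    using spos \<tau> by (intro eventually_grid_point_near) auto
  hence "\<forall>\<^sub>F n in sequentially. \<exists>k<p * 2^n.
           x (real k * (\<tau> / 2^n)) \<notin> B \<and> x (real (Suc k) * (\<tau> / 2^n)) \<in> B - C"
  proof eventually_elim
    case (elim n)
    then obtain j where j: "j \<ge> 1" "x (real j * (\<tau> / 2^n)) = x s"
      "real j * (\<tau> / 2^n) < s + 1" "real (j - 1) * (\<tau> / 2^n) < s" by auto
    then obtain k where k: "j = Suc k" by (cases j) auto
    have "x (real k * (\<tau> / 2^n)) \<notin> B"
      using before[of "real k * (\<tau> / 2^n)"] j x0 k \<tau> by (cases "k = 0") auto
    moreover have "real j * (\<tau> / 2^n) < real p * \<tau>" using j p by linarith
    hence "real j < real (p * 2^n)" using \<tau> by (simp add: field_simps)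
    hence "j < p * 2^n" unfolding of_nat_less_iff .
    ultimately show ?case using j xs xs' k by (intro exI[of _ k]) auto
  qed
  thus ?thesis by blast
qed

end

section \<open>The sampled chain killed in a set\<close>
lemma filterlim_dyadic_mesh:
  fixes \<tau> :: real
  assumes "\<tau> > 0"
  shows "filterlim (\<lambda>n. \<tau> / 2^n) (at_right 0) sequentially"
proof -
  have "(\<lambda>n. \<tau> / 2^n) \<longlonglongrightarrow> 0" by (rule LIMSEQ_divide_realpow_zero) simp
  moreover have "\<forall>n. \<tau> / 2^n \<in> {0<..} \<and> \<tau> / 2^n \<noteq> 0" using assms by simp
  ultimately show ?thesis unfolding filterlim_at by (blast intro: always_eventually)
qed

definition generator :: "'s set \<Rightarrow> ('s \<Rightarrow> 's \<Rightarrow> real) \<Rightarrow> ('s \<Rightarrow> real) \<Rightarrow> 's \<Rightarrow> real" where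
  "generator S q g i = (\<Sum>j\<in>S. q i j * (g j - g i))"

text \<open>The limits that define the rates hold uniformly over the finitely many pairs of states, and the rows
  of \<open>P \<delta>\<close> sum to \<open>1\<close>; so the drift over a step \<open>\<delta>\<close> is \<open>\<delta> Q g + o(\<delta>)\<close>, uniformly in \<open>i\<close>.\<close>
lemma transition_function_generator:
  assumes P: "transition_function S q P" and S: "finite S" and e: "e > 0"
  shows "\<forall>\<^sub>F \<delta> in at_right 0. \<forall>i\<in>S.
           \<bar>(\<Sum>j\<in>S. P \<delta> i j * g j) - g i - \<delta> * generator S q g i\<bar> \<le> \<delta> * e"
proof (intro eventually_ball_finite S ballI)
  fix i assume i: "i \<in> S"
  have "((\<lambda>\<delta>. P \<delta> i j / \<delta> * (g j - g i)) \<longlongrightarrow> q i j * (g j - g i)) (at_right 0)" if "j \<in> S" for j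
  proof (cases "i = j")
    case False
    hence "((\<lambda>\<delta>. P \<delta> i j / \<delta>) \<longlongrightarrow> q i j) (at_right 0)"
      using P i that by (simp add: transition_function_def)
    thus ?thesis by (intro tendsto_intros)
  qed simp
  hence "((\<lambda>\<delta>. \<Sum>j\<in>S. P \<delta> i j / \<delta> * (g j - g i)) \<longlongrightarrow> generator S q g i) (at_right 0)"
    unfolding generator_def by (intro tendsto_sum)
  hence "\<forall>\<^sub>F \<delta> in at_right 0. dist (\<Sum>j\<in>S. P \<delta> i j / \<delta> * (g j - g i)) (generator S q g i) < e"
    using e by (rule tendstoD)
  moreover have "\<forall>\<^sub>F \<delta> in at_right (0::real). \<delta> > 0" by (rule eventually_at_right_less)
  ultimately show "\<forall>\<^sub>F \<delta> in at_right 0.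
      \<bar>(\<Sum>j\<in>S. P \<delta> i j * g j) - g i - \<delta> * generator S q g i\<bar> \<le> \<delta> * e"
  proof eventually_elim
    case (elim \<delta>)
    have "(\<Sum>j\<in>S. P \<delta> i j) = 1" using P i elim by (simp add: transition_function_def)
    hence "(\<Sum>j\<in>S. P \<delta> i j * g j) - g i = (\<Sum>j\<in>S. P \<delta> i j * g j) - (\<Sum>j\<in>S. P \<delta> i j) * g i"
      by simp
    also have "\<dots> = (\<Sum>j\<in>S. P \<delta> i j * (g j - g i))"
      by (simp add: sum_distrib_right sum_subtractf right_diff_distrib)
    also have "\<dots> = \<delta> * (\<Sum>j\<in>S. P \<delta> i j / \<delta> * (g j - g i))"
      using elim by (simp add: sum_distrib_left)
    finally have "(\<Sum>j\<in>S. P \<delta> i j * g j) - g i - \<delta> * generator S q g i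
        = \<delta> * ((\<Sum>j\<in>S. P \<delta> i j / \<delta> * (g j - g i)) - generator S q g i)"
      by (simp add: right_diff_distrib)
    thus ?case using elim by (simp add: abs_mult dist_real_def)
  qed
qed

text \<open>The Markov property asserts that some transition function exists; fixing it as a parameter lets the
  facts below refer to one and the same \<open>P\<close>. The chain is killed on entering \<open>B\<close>.\<close>
locale killed_chain = markov_chain M S q X a
  for M :: "'a measure" and S :: "'s set" and q and X and a +
  fixes P :: "real \<Rightarrow> 's \<Rightarrow> 's \<Rightarrow> real" and B :: "'s set"
  assumes P: "transition_function S q P"
    and P_markov: "\<And>s t A i j. s \<ge> 0 \<Longrightarrow> t \<ge> 0 \<Longrightarrow> A \<in> sets (past M X s) \<Longrightarrow> i \<in> S \<Longrightarrow> j \<in> S \<Longrightarrow>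
      prob {\<omega>\<in>A. X s \<omega> = i \<and> X (s + t) \<omega> = j} = prob {\<omega>\<in>A. X s \<omega> = i} * P t i j"
    and a_B: "a \<notin> B"
begin

lemma X_in_S: "t \<ge> 0 \<Longrightarrow> \<omega> \<in> space M \<Longrightarrow> X t \<omega> \<in> S"
  using measurable_space[OF measurable_X] by fastforce

lemma X_event: 
  assumes "t \<ge> 0" shows "{\<omega>\<in>space M. X t \<omega> \<in> C} \<in> events"
proof -
  have "X t -` (C \<inter> S) \<inter> space M \<in> events"
    by (rule measurable_sets[OF measurable_X[OF assms]]) simp
  also have "X t -` (C \<inter> S) \<inter> space M = {\<omega>\<in>space M. X t \<omega> \<in> C}"
    using X_in_S[OF assms] by auto
  finally show ?thesis .
qed

lemma X_event_eq: "t \<ge> 0 \<Longrightarrow> {\<omega>\<in>space M. X t \<omega> = i} \<in> events"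
  using X_event[of t "{i}"] by simp

lemma a_in_S: "a \<in> S"
proof -
  have "\<not> (AE \<omega> in M. False)" by (simp add: AE_False)
  moreover have "AE \<omega> in M. False" if "a \<notin> S"
    using start AE_space by eventually_elim (use X_in_S[of 0] that in auto)
  ultimately show ?thesis by blast
qed

definition avoid :: "real \<Rightarrow> nat \<Rightarrow> 'a set" where
  "avoid \<delta> k = {\<omega>\<in>space M. \<forall>j\<in>{1..k}. X (real j * \<delta>) \<omega> \<notin> B}"

lemma avoid_past:
  assumes "\<delta> \<ge> 0" shows "avoid \<delta> k \<in> sets (past M X (real k * \<delta>))"
proof -
  let ?N = "past M X (real k * \<delta>)"
  have sub: "{X u -` B \<inter> space M | u B. 0 \<le> u \<and> u \<le> real k * \<delta>} \<subseteq> Pow (space M)" by auto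
  have space: "space ?N = space M" unfolding past_def by (rule space_measure_of[OF sub])
  have gen: "X u -` C \<inter> space M \<in> sets ?N" if "0 \<le> u" "u \<le> real k * \<delta>" for u C
    unfolding past_def sets_measure_of[OF sub] using that by (intro sigma_sets.Basic) auto
  have "(\<Union>j\<in>{1..k}. X (real j * \<delta>) -` B \<inter> space M) \<in> sets ?N"
    using assms by (intro sets.finite_UN gen) (auto intro!: mult_right_mono)
  hence "space ?N - (\<Union>j\<in>{1..k}. X (real j * \<delta>) -` B \<inter> space M) \<in> sets ?N" by (rule sets.compl_sets)
  also have "space ?N - (\<Union>j\<in>{1..k}. X (real j * \<delta>) -` B \<inter> space M) = avoid \<delta> k"
    unfolding space avoid_def by auto
  finally show ?thesis .
qed

lemma avoid_event:
  assumes "\<delta> \<ge> 0" shows "avoid \<delta> k \<in> events"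
proof -
  have "space M - (\<Union>j\<in>{1..k}. {\<omega>\<in>space M. X (real j * \<delta>) \<omega> \<in> B}) \<in> events"
    using assms by (intro sets.Diff sets.top sets.finite_UN X_event) auto
  also have "space M - (\<Union>j\<in>{1..k}. {\<omega>\<in>space M. X (real j * \<delta>) \<omega> \<in> B}) = avoid \<delta> k"
    by (auto simp: avoid_def)
  finally show ?thesis .
qed

lemma avoid_0: "avoid \<delta> 0 = space M" by (simp add: avoid_def)

lemma avoid_antimono: "k \<le> l \<Longrightarrow> avoid \<delta> l \<subseteq> avoid \<delta> k"
  by (auto simp: avoid_def)

text \<open>The sub-probability distribution, at step \<open>k\<close>, of the sampled chain killed in \<open>B\<close>.\<close>
definition live :: "real \<Rightarrow> nat \<Rightarrow> 's \<Rightarrow> real" where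
  "live \<delta> k i = prob {\<omega>\<in>avoid \<delta> k. X (real k * \<delta>) \<omega> = i}"

lemma live_event: "\<delta> \<ge> 0 \<Longrightarrow> t \<ge> 0 \<Longrightarrow> {\<omega>\<in>avoid \<delta> k. X t \<omega> = i} \<in> events"
proof -
  assume "\<delta> \<ge> 0" "t \<ge> 0"
  hence "avoid \<delta> k \<inter> {\<omega>\<in>space M. X t \<omega> = i} \<in> events"
    by (intro sets.Int avoid_event X_event_eq)
  also have "avoid \<delta> k \<inter> {\<omega>\<in>space M. X t \<omega> = i} = {\<omega>\<in>avoid \<delta> k. X t \<omega> = i}"
    by (auto simp: avoid_def)
  finally show ?thesis .
qed

lemma live_nonneg: "live \<delta> k i \<ge> 0" by (simp add: live_def)

lemma prob_avoid:
  assumes "\<delta> \<ge> 0" shows "prob (avoid \<delta> k) = (\<Sum>i\<in>S. live \<delta> k i)"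
proof -
  have "avoid \<delta> k = (\<Union>i\<in>S. {\<omega>\<in>avoid \<delta> k. X (real k * \<delta>) \<omega> = i})"
    using X_in_S[of "real k * \<delta>"] assms by (auto simp: avoid_def)
  also have "prob \<dots> = (\<Sum>i\<in>S. live \<delta> k i)"
    unfolding live_def using assms
    by (intro finite_measure_finite_Union finite_states image_subsetI live_event)
      (auto simp: disjoint_family_on_def)
  finally show ?thesis .
qed

lemma live_0:
  assumes "i \<in> S" shows "live \<delta> 0 i = of_bool (i = a)"
proof -
  have "live \<delta> 0 i = prob {\<omega>\<in>space M. X 0 \<omega> = i}" by (simp add: live_def avoid_0)
  also have "\<dots> = of_bool (i = a)"
  proof (cases "i = a")
    case True
    thus ?thesis using start prob_Collect_eq_1[OF X_event_eq[of 0 a]] by simp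
  next
    case False
    have "AE \<omega> in M. X 0 \<omega> \<noteq> i" using start False by auto
    thus ?thesis using False prob_Collect_eq_0[OF X_event_eq[of 0 i]] by simp
  qed
  finally show ?thesis .
qed

text \<open>The index \<open>j = 0\<close> is left out of \<open>avoid\<close>, as the hitting time looks at positive times only;
  at \<open>k = 0\<close> the claim rests on the initial state instead.\<close>
lemma live_B:
  assumes "i \<in> S" "i \<in> B" shows "live \<delta> k i = 0"
proof (cases "k = 0")
  case True
  thus ?thesis using live_0[of i \<delta>] assms a_B by auto
next
  case False
  hence "{\<omega>\<in>avoid \<delta> k. X (real k * \<delta>) \<omega> = i} = {}" using assms by (auto simp: avoid_def)
  thus ?thesis unfolding live_def by (simp only: measure_empty)
qed

lemma live_Suc:
  assumes \<delta>: "\<delta> \<ge> 0" and j: "j \<in> S" "j \<notin> B"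
  shows "live \<delta> (Suc k) j = (\<Sum>i\<in>S. live \<delta> k i * P \<delta> i j)"
proof -
  have eq: "real (Suc k) * \<delta> = real k * \<delta> + \<delta>" by (simp add: algebra_simps)
  have "{\<omega>\<in>avoid \<delta> (Suc k). X (real (Suc k) * \<delta>) \<omega> = j} =
      (\<Union>i\<in>S. {\<omega>\<in>avoid \<delta> k. X (real k * \<delta>) \<omega> = i \<and> X (real k * \<delta> + \<delta>) \<omega> = j})"
    unfolding eq[symmetric] using X_in_S[of "real k * \<delta>"] \<delta> j
    by (auto simp: avoid_def le_Suc_eq simp del: of_nat_Suc)
  hence "live \<delta> (Suc k) j =
      prob (\<Union>i\<in>S. {\<omega>\<in>avoid \<delta> k. X (real k * \<delta>) \<omega> = i \<and> X (real k * \<delta> + \<delta>) \<omega> = j})"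
    by (simp add: live_def)
  also have "\<dots> = (\<Sum>i\<in>S. prob {\<omega>\<in>avoid \<delta> k. X (real k * \<delta>) \<omega> = i \<and> X (real k * \<delta> + \<delta>) \<omega> = j})"
  proof (intro finite_measure_finite_Union finite_states image_subsetI)
    fix i
    have "{\<omega>\<in>avoid \<delta> k. X (real k * \<delta>) \<omega> = i} \<inter> {\<omega>\<in>avoid \<delta> k. X (real k * \<delta> + \<delta>) \<omega> = j} \<in> events"
      using \<delta> by (intro sets.Int live_event) auto
    also have "{\<omega>\<in>avoid \<delta> k. X (real k * \<delta>) \<omega> = i} \<inter> {\<omega>\<in>avoid \<delta> k. X (real k * \<delta> + \<delta>) \<omega> = j}
        = {\<omega>\<in>avoid \<delta> k. X (real k * \<delta>) \<omega> = i \<and> X (real k * \<delta> + \<delta>) \<omega> = j}" by auto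
    finally show "{\<omega>\<in>avoid \<delta> k. X (real k * \<delta>) \<omega> = i \<and> X (real k * \<delta> + \<delta>) \<omega> = j} \<in> events" .
  qed (auto simp: disjoint_family_on_def)
  also have "\<dots> = (\<Sum>i\<in>S. live \<delta> k i * P \<delta> i j)"
    unfolding live_def using \<delta> j by (intro sum.cong refl P_markov avoid_past) auto
  finally show ?thesis .
qed

text \<open>One step of the killed chain, tested against a function that vanishes on the killing set.\<close>
lemma live_step:
  assumes \<delta>: "\<delta> \<ge> 0" and g: "\<And>j. j \<in> S \<Longrightarrow> j \<in> B \<Longrightarrow> g j = 0"
  shows "(\<Sum>j\<in>S. live \<delta> (Suc k) j * g j) = (\<Sum>i\<in>S. live \<delta> k i * (\<Sum>j\<in>S. P \<delta> i j * g j))"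
proof -
  have "(\<Sum>j\<in>S. live \<delta> (Suc k) j * g j) = (\<Sum>j\<in>S. (\<Sum>i\<in>S. live \<delta> k i * P \<delta> i j) * g j)"
  proof (intro sum.cong refl)
    fix j assume "j \<in> S"
    thus "live \<delta> (Suc k) j * g j = (\<Sum>i\<in>S. live \<delta> k i * P \<delta> i j) * g j"
      using g[of j] live_Suc[OF \<delta>, of j k] by (cases "j \<in> B") auto
  qed
  also have "\<dots> = (\<Sum>i\<in>S. live \<delta> k i * (\<Sum>j\<in>S. P \<delta> i j * g j))"
    unfolding sum_distrib_left sum_distrib_right by (subst sum.swap) (simp add: mult.assoc)
  finally show ?thesis .
qed

text \<open>A grid of mesh \<open>\<delta>\<close> has \<open>O(1 / \<delta>)\<close> points in a bounded interval, and each step jumps directly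
  into \<open>B - C\<close> with probability \<open>o(\<delta>)\<close> as the corresponding rates vanish. Hence almost surely
  infinitely many of the dyadic grids see no such step, while a path that enters \<open>B\<close> outside \<open>C\<close>
  shows one on all fine grids.\<close>
lemma AE_no_skip:
  assumes C: "C \<subseteq> B" and q0: "\<And>i j. i \<in> S \<Longrightarrow> i \<notin> B \<Longrightarrow> j \<in> S \<Longrightarrow> j \<in> B - C \<Longrightarrow> q i j = 0"
  shows "AE \<omega> in M. hit (\<lambda>t. X t \<omega>) B = hit (\<lambda>t. X t \<omega>) C"
proof -
  define D :: "nat \<Rightarrow> real" where "D n = 1 / 2 ^ n" for n
  have D: "D n > 0" for n by (simp add: D_def)
  define jump where "jump n k = {\<omega>\<in>space M. X (real k * D n) \<omega> \<notin> B \<and> X (real (Suc k) * D n) \<omega> \<in> B - C}" for n k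
  define skip where "skip p n = (\<Union>k<p * 2^n. jump n k)" for p n
  have jump_event: "jump n k \<in> events" for n k
  proof -
    have "{\<omega>\<in>space M. X (real k * D n) \<omega> \<in> - B} \<inter> {\<omega>\<in>space M. X (real (Suc k) * D n) \<omega> \<in> B - C} \<in> events"
      using D[of n] by (intro sets.Int X_event) auto
    also have "{\<omega>\<in>space M. X (real k * D n) \<omega> \<in> - B} \<inter> {\<omega>\<in>space M. X (real (Suc k) * D n) \<omega> \<in> B - C} = jump n k"
      by (auto simp: jump_def)
    finally show ?thesis .
  qed
  have skip_event: "skip p n \<in> events" for p n
    unfolding skip_def by (intro sets.finite_UN jump_event) auto
  define w where "w \<delta> = (\<Sum>i\<in>S - B. \<Sum>j\<in>S \<inter> (B - C). P \<delta> i j)" for \<delta>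
  have jump_le: "prob (jump n k) \<le> w (D n)" for n k
  proof -
    let ?J = "\<lambda>i j. {\<omega>\<in>space M. X (real k * D n) \<omega> = i \<and> X (real k * D n + D n) \<omega> = j}"
    have J: "?J i j \<in> events" for i j
    proof -
      have "{\<omega>\<in>space M. X (real k * D n) \<omega> = i} \<inter> {\<omega>\<in>space M. X (real k * D n + D n) \<omega> = j} \<in> events"
        using D[of n] by (intro sets.Int X_event_eq) auto
      also have "{\<omega>\<in>space M. X (real k * D n) \<omega> = i} \<inter> {\<omega>\<in>space M. X (real k * D n + D n) \<omega> = j} = ?J i j"
        by auto
      finally show ?thesis .
    qed
    have eq: "real (Suc k) * D n = real k * D n + D n" by (simp add: algebra_simps)
    have past: "space M \<in> sets (past M X (real k * D n))"
    proof -
      have "space (past M X (real k * D n)) = space M"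
        unfolding past_def by (rule space_measure_of) auto
      thus ?thesis using sets.top[of "past M X (real k * D n)"] by simp
    qed
    have "jump n k \<subseteq> (\<Union>i\<in>S - B. \<Union>j\<in>S \<inter> (B - C). ?J i j)"
      using X_in_S[of "real k * D n"] X_in_S[of "real k * D n + D n"] D[of n]
      unfolding jump_def eq by auto
    hence "prob (jump n k) \<le> prob (\<Union>i\<in>S - B. \<Union>j\<in>S \<inter> (B - C). ?J i j)"
      using finite_states by (intro finite_measure_mono sets.finite_UN J) auto
    also have "\<dots> \<le> (\<Sum>i\<in>S - B. prob (\<Union>j\<in>S \<inter> (B - C). ?J i j))"
      using finite_states by (intro measure_UNION_le sets.finite_UN J) auto
    also have "\<dots> \<le> (\<Sum>i\<in>S - B. \<Sum>j\<in>S \<inter> (B - C). prob (?J i j))"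
      using finite_states by (intro sum_mono measure_UNION_le J) auto
    also have "\<dots> \<le> w (D n)"
      unfolding w_def
    proof (intro sum_mono)
      fix i j assume ij: "i \<in> S - B" "j \<in> S \<inter> (B - C)"
      have "prob (?J i j) = prob {\<omega>\<in>space M. X (real k * D n) \<omega> = i} * P (D n) i j"
        using ij D[of n] by (intro P_markov past) auto
      also have "\<dots> \<le> 1 * P (D n) i j"
        using P ij D[of n] by (intro mult_right_mono) (auto simp: transition_function_def less_imp_le)
      finally show "prob (?J i j) \<le> P (D n) i j" by simp
    qed
    finally show ?thesis .
  qed
  have skip_le: "prob (skip p n) \<le> real p * (w (D n) / D n)" for p n
  proof -
    have "prob (skip p n) \<le> (\<Sum>k<p * 2^n. prob (jump n k))"
      unfolding skip_def by (intro measure_UNION_le jump_event) auto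
    also have "\<dots> \<le> (\<Sum>k<p * 2^n. w (D n))" by (intro sum_mono jump_le)
    also have "\<dots> = real p * (w (D n) / D n)" by (simp add: D_def)
    finally show ?thesis .
  qed
  have "((\<lambda>\<delta>. \<Sum>i\<in>S - B. \<Sum>j\<in>S \<inter> (B - C). P \<delta> i j / \<delta>) \<longlongrightarrow> (\<Sum>i\<in>S - B. \<Sum>j\<in>S \<inter> (B - C). q i j)) (at_right 0)"
    using P by (intro tendsto_sum) (auto simp: transition_function_def)
  also have "(\<Sum>i\<in>S - B. \<Sum>j\<in>S \<inter> (B - C). q i j) = 0"
    by (intro sum.neutral ballI q0) auto
  finally have w_lim: "((\<lambda>\<delta>. w \<delta> / \<delta>) \<longlongrightarrow> 0) (at_right 0)"
    by (simp add: w_def sum_divide_distrib)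
  have "filterlim D (at_right 0) sequentially"
    unfolding D_def by (rule filterlim_dyadic_mesh) simp
  hence wD: "(\<lambda>n. w (D n) / D n) \<longlonglongrightarrow> 0"
    by (rule filterlim_compose[OF w_lim])
  have null: "AE \<omega> in M. \<omega> \<notin> (\<Inter>n\<in>{N..}. skip p n)" for p N
  proof -
    have ev: "(\<Inter>n\<in>{N..}. skip p n) \<in> events"
      by (intro sets.countable_INT') (auto intro: skip_event)
    have "prob (\<Inter>n\<in>{N..}. skip p n) \<le> real p * (w (D n) / D n)" if "n \<ge> N" for n
    proof -
      have "prob (\<Inter>n\<in>{N..}. skip p n) \<le> prob (skip p n)"
        using that by (intro finite_measure_mono skip_event) auto
      thus ?thesis using skip_le[of p n] by linarith
    qed
    moreover have "(\<lambda>n. real p * (w (D n) / D n)) \<longlonglongrightarrow> real p * 0"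
      by (intro tendsto_intros wD)
    ultimately have "prob (\<Inter>n\<in>{N..}. skip p n) \<le> real p * 0"
      by (intro LIMSEQ_le_const) auto
    hence "prob (\<Inter>n\<in>{N..}. skip p n) = 0" by (simp add: measure_le_0_iff)
    hence "(\<Inter>n\<in>{N..}. skip p n) \<in> null_sets M"
      using ev by (simp add: null_sets_def emeasure_eq_measure)
    thus ?thesis by (rule AE_not_in)
  qed
  have "AE \<omega> in M. \<forall>p N. \<omega> \<notin> (\<Inter>n\<in>{N..}. skip p n)"
    unfolding AE_all_countable using null by blast
  with start AE_space show ?thesis
  proof eventually_elim
    case (elim \<omega>)
    let ?x = "\<lambda>t. X t \<omega>"
    have "hit ?x B \<le> hit ?x C" unfolding hit_def using C by (intro Inf_superset_mono) auto
    moreover have "\<not> hit ?x B < hit ?x C"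
    proof
      assume "hit ?x B < hit ?x C"
      hence "\<exists>p::nat. \<forall>\<^sub>F n in sequentially. \<exists>k<p * 2 ^ n.
               ?x (real k * (1 / 2 ^ n)) \<notin> B \<and> ?x (real (Suc k) * (1 / 2 ^ n)) \<in> B - C"
        using elim right_continuous C a_B by (intro hit_subset_or_grid_skip) auto
      then obtain p N where "\<And>n. n \<ge> N \<Longrightarrow> \<exists>k<p * 2 ^ n.
               ?x (real k * D n) \<notin> B \<and> ?x (real (Suc k) * D n) \<in> B - C"
        unfolding eventually_sequentially D_def by blast
      hence "\<omega> \<in> (\<Inter>n\<in>{N..}. skip p n)"
        using elim unfolding skip_def jump_def by blast
      thus False using elim by blast
    qed
    ultimately show ?case by simp
  qed
qed

end

context killed_chain
begin

text \<open>Along dyadic meshes the sampled survival events decrease to the survival event in continuous time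
  and the sampled hitting times decrease to the hitting time.\<close>
lemma decseq_avoid_dyadic: "decseq (\<lambda>n. avoid (\<tau> / 2^n) (p * 2^n))"
proof (rule decseq_SucI, rule subsetI)
  fix n \<omega> assume \<omega>: "\<omega> \<in> avoid (\<tau> / 2^Suc n) (p * 2^Suc n)"
  have "X (real j * (\<tau> / 2^n)) \<omega> \<notin> B" if "j \<in> {1..p * 2^n}" for j
  proof -
    have "2 * j \<in> {1..p * 2^Suc n}" using that by auto
    hence "X (real (2 * j) * (\<tau> / 2^Suc n)) \<omega> \<notin> B" using \<omega> unfolding avoid_def by blast
    thus ?thesis by simp
  qed
  thus "\<omega> \<in> avoid (\<tau> / 2^n) (p * 2^n)" using \<omega> by (simp add: avoid_def)
qed

lemma prob_avoid_dyadic_tendsto: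
  assumes \<tau>: "\<tau> > 0" and p: "p > 0"
  shows "(\<lambda>n. prob (avoid (\<tau> / 2^n) (p * 2^n))) \<longlonglongrightarrow>
    prob {\<omega>\<in>space M. ennreal (real p * \<tau>) < hit (\<lambda>t. X t \<omega>) B}"
proof -
  have "(\<lambda>n. prob (avoid (\<tau> / 2^n) (p * 2^n))) \<longlonglongrightarrow> prob (\<Inter>n. avoid (\<tau> / 2^n) (p * 2^n))"
    using \<tau> avoid_event decseq_avoid_dyadic by (intro finite_Lim_measure_decseq) auto
  moreover have "(\<Inter>n. avoid (\<tau> / 2^n) (p * 2^n))
      = {\<omega>\<in>space M. ennreal (real p * \<tau>) < hit (\<lambda>t. X t \<omega>) B}"
    using less_hit_iff_grid[OF right_continuous \<tau> p] by (auto simp: avoid_def)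
  ultimately show ?thesis by simp
qed

lemma grid_hit_avoid:
  assumes "\<delta> > 0" "\<omega> \<in> space M"
  shows "grid_hit (\<lambda>t. X t \<omega>) B \<delta> = (\<Sum>k. ennreal \<delta> * indicator (avoid \<delta> k) \<omega>)"
  unfolding grid_hit_eq_suminf[OF assms(1)] using assms(2)
  by (intro suminf_cong) (auto simp: avoid_def indicator_def)

lemma grid_hit_measurable:
  assumes "\<delta> > 0"
  shows "(\<lambda>\<omega>. grid_hit (\<lambda>t. X t \<omega>) B \<delta>) \<in> borel_measurable M"
proof -
  have [measurable]: "avoid \<delta> k \<in> events" for k using assms by (intro avoid_event) auto
  have "(\<lambda>\<omega>. \<Sum>k. ennreal \<delta> * indicator (avoid \<delta> k) \<omega>) \<in> borel_measurable M" by measurable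
  thus ?thesis using grid_hit_avoid[OF assms] by (simp cong: measurable_cong)
qed

lemma hit_measurable: "(\<lambda>\<omega>. hit (\<lambda>t. X t \<omega>) B) \<in> borel_measurable M"
proof -
  have [measurable]: "(\<lambda>\<omega>. grid_hit (\<lambda>t. X t \<omega>) B (1 / 2^n)) \<in> borel_measurable M" for n
    by (intro grid_hit_measurable) auto
  have "(\<lambda>\<omega>. INF n. grid_hit (\<lambda>t. X t \<omega>) B (1 / 2^n)) \<in> borel_measurable M" by measurable
  moreover have "hit (\<lambda>t. X t \<omega>) B = (INF n. grid_hit (\<lambda>t. X t \<omega>) B (1 / 2^n))"
    if "\<omega> \<in> space M" for \<omega>
    using right_continuous[OF _ that] by (intro hit_eq_INF_grid_hit) auto
  ultimately show ?thesis by (simp cong: measurable_cong)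
qed

lemma nn_integral_grid_hit:
  assumes \<delta>: "\<delta> > 0" and summ: "summable (\<lambda>k. prob (avoid \<delta> k))"
  shows "(\<integral>\<^sup>+\<omega>. grid_hit (\<lambda>t. X t \<omega>) B \<delta> \<partial>M) = ennreal (\<delta> * (\<Sum>k. prob (avoid \<delta> k)))"
proof -
  have [measurable]: "avoid \<delta> k \<in> events" for k using assms by (intro avoid_event) auto
  have "(\<integral>\<^sup>+\<omega>. grid_hit (\<lambda>t. X t \<omega>) B \<delta> \<partial>M) = (\<integral>\<^sup>+\<omega>. (\<Sum>k. ennreal \<delta> * indicator (avoid \<delta> k) \<omega>) \<partial>M)"
    by (intro nn_integral_cong grid_hit_avoid \<delta>)
  also have "\<dots> = (\<Sum>k. \<integral>\<^sup>+\<omega>. ennreal \<delta> * indicator (avoid \<delta> k) \<omega> \<partial>M)"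
    by (intro nn_integral_suminf) measurable
  also have "\<dots> = (\<Sum>k. ennreal (\<delta> * prob (avoid \<delta> k)))"
    using \<delta> by (intro suminf_cong) (simp add: nn_integral_cmult_indicator emeasure_eq_measure ennreal_mult)
  also have "\<dots> = ennreal (\<delta> * (\<Sum>k. prob (avoid \<delta> k)))"
    using \<delta> summ by (subst suminf_ennreal2) (auto simp: suminf_mult)
  finally show ?thesis .
qed

lemma nn_integral_hit_bounds:
  assumes ev: "\<forall>\<^sub>F \<delta> in at_right 0. summable (\<lambda>k. prob (avoid \<delta> k)) \<and>
    \<delta> * (\<Sum>k. prob (avoid \<delta> k)) \<in> {lo..hi}"
  shows "ennreal lo \<le> (\<integral>\<^sup>+\<omega>. hit (\<lambda>t. X t \<omega>) B \<partial>M)" "(\<integral>\<^sup>+\<omega>. hit (\<lambda>t. X t \<omega>) B \<partial>M) \<le> ennreal hi"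
proof -
  define g where "g n \<omega> = grid_hit (\<lambda>t. X t \<omega>) B (1 / 2^n)" for n \<omega>
  have "\<forall>\<^sub>F n in sequentially. integral\<^sup>N M (g n) \<in> {ennreal lo..ennreal hi}"
    using eventually_compose_filterlim[OF ev filterlim_dyadic_mesh[OF zero_less_one]]
  proof eventually_elim
    case (elim n)
    thus ?case unfolding g_def by (subst nn_integral_grid_hit) (auto intro: ennreal_leI)
  qed
  then obtain N where N: "\<And>n. n \<ge> N \<Longrightarrow> integral\<^sup>N M (g n) \<in> {ennreal lo..ennreal hi}"
    by (auto simp: eventually_sequentially)
  have dec: "decseq g"
    using grid_hit_halve[of "1 / 2^n" for n] by (intro decseq_SucI le_funI) (simp add: g_def mult.commute)
  have "(\<integral>\<^sup>+\<omega>. hit (\<lambda>t. X t \<omega>) B \<partial>M) = (\<integral>\<^sup>+\<omega>. (INF n. g n \<omega>) \<partial>M)"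
    unfolding g_def using right_continuous by (intro nn_integral_cong hit_eq_INF_grid_hit) auto
  also have "\<dots> = (INF n. integral\<^sup>N M (g n))"
  proof (rule nn_integral_monotone_convergence_INF_decseq[OF dec])
    show "g n \<in> borel_measurable M" for n
      unfolding g_def by (rule grid_hit_measurable) simp
    show "integral\<^sup>N M (g N) < \<infinity>" using N[OF order_refl] by (auto intro: le_less_trans)
  qed
  finally have eq: "(\<integral>\<^sup>+\<omega>. hit (\<lambda>t. X t \<omega>) B \<partial>M) = (INF n. integral\<^sup>N M (g n))" .
  show "ennreal lo \<le> (\<integral>\<^sup>+\<omega>. hit (\<lambda>t. X t \<omega>) B \<partial>M)"
    unfolding eq
  proof (rule INF_greatest)
    fix n
    have "ennreal lo \<le> integral\<^sup>N M (g (max n N))" using N[of "max n N"] by auto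
    also have "\<dots> \<le> integral\<^sup>N M (g n)"
      using decseqD[OF dec, of n "max n N"] by (intro nn_integral_mono) (auto simp: le_fun_def)
    finally show "ennreal lo \<le> integral\<^sup>N M (g n)" .
  qed
  show "(\<integral>\<^sup>+\<omega>. hit (\<lambda>t. X t \<omega>) B \<partial>M) \<le> ennreal hi"
    unfolding eq using N[OF order_refl] by (intro INF_lower2[of N]) auto
qed

end

section \<open>Chains with a metastable set\<close>

text \<open>The set \<open>Z\<close> is the complement of the well. The equation for \<open>f\<close> says that \<open>f i\<close> is the mean time
  to reach \<open>B\<close> from \<open>i\<close>; \<open>h\<close> is a Lyapunov function that bounds the expected time in \<open>Z\<close>.
  The same \<open>\<epsilon>\<close> measures all errors, including the one made by replacing the generator by a small
  time step.\<close>
locale metastable_chain = killed_chain M S q X a P B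
  for M :: "'a measure" and S :: "'s set" and q X a P B +
  fixes f h :: "'s \<Rightarrow> real" and Z :: "'s set" and m \<epsilon> :: real
  assumes \<epsilon>: "0 < \<epsilon>" "\<epsilon> < 1" and m: "m > 0"
    and f_nonneg: "\<And>i. i \<in> S \<Longrightarrow> 0 \<le> f i" and f_le: "\<And>i. i \<in> S \<Longrightarrow> f i \<le> m"
    and f_B: "\<And>i. i \<in> S \<Longrightarrow> i \<in> B \<Longrightarrow> f i = 0"
    and f_gen: "\<And>i. i \<in> S \<Longrightarrow> i \<notin> B \<Longrightarrow> generator S q f i = -1"
    and f_large: "\<And>i. i \<in> S \<Longrightarrow> i \<notin> B \<Longrightarrow> i \<notin> Z \<Longrightarrow> (1 - \<epsilon>) * m \<le> f i"
    and f_start: "(1 - \<epsilon>) * m \<le> f a"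
    and h_nonneg: "\<And>i. i \<in> S \<Longrightarrow> 0 \<le> h i"
    and h_B: "\<And>i. i \<in> S \<Longrightarrow> i \<in> B \<Longrightarrow> h i = 0"
    and h_gen: "\<And>i. i \<in> S \<Longrightarrow> i \<notin> B \<Longrightarrow> generator S q h i \<le> - of_bool (i \<in> Z)"
    and h_start: "h a \<le> \<epsilon> * m"
begin

text \<open>The upper bound for the mean hitting time has to absorb the relative error \<open>\<epsilon>\<close> in the drift.\<close>
abbreviation "m' \<equiv> m / (1 - \<epsilon>)"
abbreviation "v \<equiv> moment_ratio \<epsilon>"

lemma m'_pos: "m' > 0" using m \<epsilon> by simp

text \<open>For every sufficiently fine grid the hypotheses of \<open>lyapunov_moments\<close> hold, with the error in the
  drift chosen equal to \<open>\<epsilon>\<close>.\<close>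
lemma grid_moments:
  "\<forall>\<^sub>F \<delta> in at_right 0.
     summable (\<lambda>k. prob (avoid \<delta> k)) \<and>
     (\<forall>k. \<delta> * (\<Sum>j. prob (avoid \<delta> (j + k))) \<le> m' * prob (avoid \<delta> k)) \<and>
     (1 - \<epsilon>) / (1 + \<epsilon>) * m \<le> \<delta> * (\<Sum>j. prob (avoid \<delta> j)) \<and>
     v * m'^2 \<le> \<delta> * (\<Sum>k. \<delta> * (\<Sum>j. prob (avoid \<delta> (j + k))))"
proof -
  have tf: "\<forall>\<^sub>F \<delta> in at_right 0. \<forall>i\<in>S.
           \<bar>(\<Sum>j\<in>S. P \<delta> i j * g j) - g i - \<delta> * generator S q g i\<bar> \<le> \<delta> * \<epsilon>" for g
    by (rule transition_function_generator[OF P finite_states \<epsilon>(1)])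
  have "\<forall>\<^sub>F \<delta> in at_right (0::real). \<delta> > 0" by (rule eventually_at_right_less)
  with tf[of f] tf[of h] show ?thesis
  proof eventually_elim
    case (elim \<delta>)
    define s where "s k = prob (avoid \<delta> k)" for k
    define z where "z k = (\<Sum>i\<in>S. live \<delta> k i * of_bool (i \<in> Z))" for k
    define F where "F k = (\<Sum>i\<in>S. live \<delta> k i * f i)" for k
    define H where "H k = (\<Sum>i\<in>S. live \<delta> k i * h i)" for k
    have \<delta>: "\<delta> > 0" "\<delta> \<ge> 0" using elim by auto
    have s: "s k = (\<Sum>i\<in>S. live \<delta> k i)" for k unfolding s_def by (rule prob_avoid[OF \<delta>(2)])
    have mono: "(\<Sum>i\<in>S. live \<delta> k i * g1 i) \<le> (\<Sum>i\<in>S. live \<delta> k i * g2 i)"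
      if "\<And>i. i \<in> S \<Longrightarrow> i \<notin> B \<Longrightarrow> g1 i \<le> g2 i" for k and g1 g2 :: "'s \<Rightarrow> real"
    proof (rule sum_mono)
      fix i assume "i \<in> S"
      thus "live \<delta> k i * g1 i \<le> live \<delta> k i * g2 i"
        using that[of i] live_B[of i \<delta> k] live_nonneg[of \<delta> k i]
        by (cases "i \<in> B") (auto intro: mult_left_mono)
    qed
    have drift: "(\<Sum>i\<in>S. live \<delta> k i * g i) - (\<Sum>i\<in>S. live \<delta> (Suc k) i * g i)
        = (\<Sum>i\<in>S. live \<delta> k i * (g i - (\<Sum>j\<in>S. P \<delta> i j * g j)))"
      if "\<And>j. j \<in> S \<Longrightarrow> j \<in> B \<Longrightarrow> g j = 0" for k g
      using live_step[OF \<delta>(2) that, where k = k] by (simp add: sum_subtractf right_diff_distrib)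
    have dF: "F k - F (Suc k) = (\<Sum>i\<in>S. live \<delta> k i * (f i - (\<Sum>j\<in>S. P \<delta> i j * f j)))" for k
      unfolding F_def by (rule drift) (rule f_B)
    have dH: "H k - H (Suc k) = (\<Sum>i\<in>S. live \<delta> k i * (h i - (\<Sum>j\<in>S. P \<delta> i j * h j)))" for k
      unfolding H_def by (rule drift) (rule h_B)
    have f_drift: "\<delta> * (1 - \<epsilon>) \<le> f i - (\<Sum>j\<in>S. P \<delta> i j * f j)"
        "f i - (\<Sum>j\<in>S. P \<delta> i j * f j) \<le> \<delta> * (1 + \<epsilon>)" if "i \<in> S" "i \<notin> B" for i
      using elim(1)[rule_format, OF that(1)] f_gen[OF that] by (auto simp: abs_le_iff algebra_simps)
    have h_drift: "\<delta> * (of_bool (i \<in> Z) - \<epsilon>) \<le> h i - (\<Sum>j\<in>S. P \<delta> i j * h j)"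
      if "i \<in> S" "i \<notin> B" for i
    proof -
      have "\<delta> * generator S q h i \<le> \<delta> * (- of_bool (i \<in> Z))"
        using h_gen[OF that] \<delta> by (intro mult_left_mono) auto
      thus ?thesis
        using elim(2)[rule_format, OF that(1)] by (simp add: abs_le_iff algebra_simps)
    qed
    have const: "(\<Sum>i\<in>S. live \<delta> k i * c) = c * s k" for k c
      by (simp add: s sum_distrib_left mult.commute)
    note * = lyapunov_moments[of \<delta> \<epsilon> m s z F H, OF \<delta>(1) \<epsilon> m]
    have 1: "s k \<ge> 0" for k by (simp add: s_def)
    have 2: "z k \<ge> 0" for k unfolding z_def by (intro sum_nonneg mult_nonneg_nonneg live_nonneg) auto
    have 3: "F k \<ge> 0" for k unfolding F_def by (intro sum_nonneg mult_nonneg_nonneg live_nonneg f_nonneg)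
    have 4: "F k \<le> m * s k" for k
      unfolding F_def const[symmetric] by (intro mono f_le)
    have 5: "(1 - \<epsilon>) * m * (s k - z k) \<le> F k" for k
    proof -
      have "(1 - \<epsilon>) * m * (s k - z k) = (\<Sum>i\<in>S. live \<delta> k i * ((1 - \<epsilon>) * m * (1 - of_bool (i \<in> Z))))"
        unfolding s z_def by (simp add: sum_distrib_left sum_subtractf [symmetric] algebra_simps)
      also have "\<dots> \<le> F k"
        unfolding F_def using f_large f_nonneg by (intro mono) auto
      finally show ?thesis .
    qed
    have 6: "\<delta> * (1 - \<epsilon>) * s k \<le> F k - F (Suc k)" for k
      unfolding dF const[symmetric] by (intro mono f_drift)
    have 7: "F k - F (Suc k) \<le> \<delta> * (1 + \<epsilon>) * s k" for k
      unfolding dF const[symmetric] by (intro mono f_drift)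
    have 8: "H k \<ge> 0" for k unfolding H_def by (intro sum_nonneg mult_nonneg_nonneg live_nonneg h_nonneg)
    have 9: "\<delta> * (z k - \<epsilon> * s k) \<le> H k - H (Suc k)" for k
    proof -
      have "\<delta> * (z k - \<epsilon> * s k) = (\<Sum>i\<in>S. live \<delta> k i * (\<delta> * (of_bool (i \<in> Z) - \<epsilon>)))"
        unfolding s z_def by (simp add: sum_distrib_left sum_subtractf [symmetric] algebra_simps)
      also have "\<dots> \<le> H k - H (Suc k)"
        unfolding dH by (intro mono h_drift)
      finally show ?thesis .
    qed
    have init: "(\<Sum>i\<in>S. live \<delta> 0 i * g i) = g a" for g :: "'s \<Rightarrow> real"
    proof -
      have "(\<Sum>i\<in>S. live \<delta> 0 i * g i) = (\<Sum>i\<in>S. if i = a then g i else 0)"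
        by (intro sum.cong) (auto simp: live_0)
      thus ?thesis using a_in_S finite_states by simp
    qed
    have 10: "(1 - \<epsilon>) * m \<le> F 0" unfolding F_def init by (rule f_start)
    have 11: "H 0 \<le> \<epsilon> * m" unfolding H_def init by (rule h_start)
    note * = *[OF 1 2 3 4 5 6 7 8 9 10 11]
    show ?case using * unfolding s_def by auto
  qed
qed

lemma grid_tail_bounds:
  "\<forall>\<^sub>F \<delta> in at_right 0.
     (\<forall>k. exp (- (real k * \<delta>) / (m' - \<delta>)) - (1 - v) \<le> prob (avoid \<delta> k)) \<and>
     (\<forall>k l. l > 0 \<longrightarrow> prob (avoid \<delta> (k + l)) \<le> exp (- (real k * \<delta>) / m') + m' * (1 - v) / (real l * \<delta>))"
proof -
  have "\<forall>\<^sub>F \<delta> in at_right (0::real). \<delta> > 0" by (rule eventually_at_right_less)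
  moreover have "\<forall>\<^sub>F \<delta> in at_right (0::real). \<delta> < m'"
    using m'_pos by (rule order_tendstoD[OF tendsto_ident_at])
  ultimately show ?thesis using grid_moments
  proof eventually_elim
    case (elim \<delta>)
    define s where "s k = prob (avoid \<delta> k)" for k
    have anti: "antimono s"
      unfolding s_def antimono_def using elim(1)
      by (auto intro!: finite_measure_mono avoid_antimono avoid_event)
    have s0: "s 0 = 1" by (simp add: s_def avoid_0 prob_space)
    note * = tail_sandwich[of \<delta> m' s v, OF elim(1) m'_pos s0 anti]
    have "exp (- (real k * \<delta>) / (m' - \<delta>)) - (1 - v) \<le> s k" for k
      using *(2)[of k] exp_le_one_minus_power[of \<delta> m' k] elim unfolding s_def by force
    moreover have "s (k + l) \<le> exp (- (real k * \<delta>) / m') + m' * (1 - v) / (real l * \<delta>)" if "l > 0" for k l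
      using *(3)[of l k] one_minus_power_le_exp[OF m'_pos, of \<delta> k] elim that unfolding s_def by force
    ultimately show ?case by (simp add: s_def)
  qed
qed

lemma nn_integral_hit:
  "ennreal ((1 - \<epsilon>) / (1 + \<epsilon>) * m) \<le> (\<integral>\<^sup>+\<omega>. hit (\<lambda>t. X t \<omega>) B \<partial>M)"
  "(\<integral>\<^sup>+\<omega>. hit (\<lambda>t. X t \<omega>) B \<partial>M) \<le> ennreal m'"
proof -
  have "\<forall>\<^sub>F \<delta> in at_right 0. summable (\<lambda>k. prob (avoid \<delta> k)) \<and>
    \<delta> * (\<Sum>k. prob (avoid \<delta> k)) \<in> {(1 - \<epsilon>) / (1 + \<epsilon>) * m..m'}"
    using grid_moments
  proof eventually_elim
    case (elim \<delta>)
    have "\<delta> * (\<Sum>j. prob (avoid \<delta> (j + 0))) \<le> m' * prob (avoid \<delta> 0)" using elim by blast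
    thus ?case using elim by (simp add: avoid_0 prob_space)
  qed
  from nn_integral_hit_bounds[OF this] show
    "ennreal ((1 - \<epsilon>) / (1 + \<epsilon>) * m) \<le> (\<integral>\<^sup>+\<omega>. hit (\<lambda>t. X t \<omega>) B \<partial>M)"
    "(\<integral>\<^sup>+\<omega>. hit (\<lambda>t. X t \<omega>) B \<partial>M) \<le> ennreal m'" .
qed

lemma hit_tail_lower:
  assumes t: "t > 0"
  shows "exp (- t / m') - (1 - v) \<le> prob {\<omega>\<in>space M. ennreal t < hit (\<lambda>t. X t \<omega>) B}"
proof -
  have mesh: "filterlim (\<lambda>n. t / 2^n) (at_right 0) sequentially" by (rule filterlim_dyadic_mesh[OF t])
  hence mesh0: "(\<lambda>n. t / 2^n) \<longlonglongrightarrow> 0" by (simp add: filterlim_at)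
  have lim: "(\<lambda>n. exp (- t / (m' - t / 2^n)) - (1 - v)) \<longlonglongrightarrow> exp (- t / (m' - 0)) - (1 - v)"
    using m'_pos by (intro tendsto_intros mesh0) auto
  have "(\<lambda>n. prob (avoid (t / 2^n) (1 * 2^n))) \<longlonglongrightarrow> prob {\<omega>\<in>space M. ennreal (real 1 * t) < hit (\<lambda>t. X t \<omega>) B}"
    using t by (intro prob_avoid_dyadic_tendsto) auto
  moreover have "\<forall>\<^sub>F n in sequentially. exp (- t / (m' - t / 2^n)) - (1 - v) \<le> prob (avoid (t / 2^n) (1 * 2^n))"
    using eventually_compose_filterlim[OF grid_tail_bounds mesh]
  proof eventually_elim
    case (elim n)
    have "exp (- (real (2^n) * (t / 2^n)) / (m' - t / 2^n)) - (1 - v) \<le> prob (avoid (t / 2^n) (2^n))"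
      using elim by blast
    thus ?case by simp
  qed
  ultimately show ?thesis using tendsto_le[OF _ _ lim] by simp
qed

lemma hit_tail_upper:
  assumes \<tau>: "\<tau> > 0"
  shows "prob {\<omega>\<in>space M. ennreal (real (Suc p) * \<tau>) < hit (\<lambda>t. X t \<omega>) B}
    \<le> exp (- (real p * \<tau>) / m') + m' * (1 - v) / \<tau>"
proof -
  have mesh: "filterlim (\<lambda>n. \<tau> / 2^n) (at_right 0) sequentially" by (rule filterlim_dyadic_mesh[OF \<tau>])
  have "(\<lambda>n. prob (avoid (\<tau> / 2^n) (Suc p * 2^n))) \<longlonglongrightarrow>
      prob {\<omega>\<in>space M. ennreal (real (Suc p) * \<tau>) < hit (\<lambda>t. X t \<omega>) B}"
    using \<tau> by (intro prob_avoid_dyadic_tendsto) auto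
  moreover have "\<forall>\<^sub>F n in sequentially. prob (avoid (\<tau> / 2^n) (Suc p * 2^n))
      \<le> exp (- (real p * \<tau>) / m') + m' * (1 - v) / \<tau>"
    using eventually_compose_filterlim[OF grid_tail_bounds mesh]
  proof eventually_elim
    case (elim n)
    have "prob (avoid (\<tau> / 2^n) (p * 2^n + 2^n))
        \<le> exp (- (real (p * 2^n) * (\<tau> / 2^n)) / m') + m' * (1 - v) / (real (2^n) * (\<tau> / 2^n))"
      using elim by (metis zero_less_numeral zero_less_power)
    thus ?case by (simp add: add.commute)
  qed
  ultimately show ?thesis by (intro tendsto_upperbound) auto
qed

end

section \<open>The distribution function of the normalised hitting time\<close>

context metastable_chain
begin

text \<open>A lower bound for the mean hitting time in units of \<open>m'\<close>.\<close>
abbreviation "\<rho> \<equiv> (1 - \<epsilon>)^2 / (1 + \<epsilon>)"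

text \<open>The mean \<open>E\<close> satisfies \<open>\<rho> m' \<le> E \<le> m'\<close>, so the tail bounds at \<open>x E\<close> turn into bounds that
  depend on \<open>\<epsilon>\<close> alone. The integer \<open>p\<close> comes from the upper tail bound, where the tail at
  \<open>(p + 1) \<tau>\<close> is compared with the integrated tail over the last interval of length
  \<open>\<tau> = x E / (p + 1)\<close>: for fixed \<open>p\<close> the error vanishes with \<open>\<epsilon>\<close>, and \<open>p\<close> is sent to infinity
  afterwards.\<close>
lemma normalised_hit_cdf:
  assumes T: "T \<in> borel_measurable M" and eq: "AE \<omega> in M. T \<omega> = hit (\<lambda>t. X t \<omega>) B"
  defines "Y \<equiv> distr M borel (\<lambda>\<omega>. enn2real (T \<omega> / (\<integral>\<^sup>+\<omega>'. T \<omega>' \<partial>M)))"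
  shows "x \<le> 0 \<Longrightarrow> cdf Y x = 0"
    and "x > 0 \<Longrightarrow> cdf Y x \<le> 1 - exp (- x) + (1 - v)"
    and "x > 0 \<Longrightarrow> 1 - (exp (- (real p * (x / real (Suc p)) * \<rho>)) + real (Suc p) * (1 - v) / (x * \<rho>)) \<le> cdf Y x"
proof -
  have ET: "(\<integral>\<^sup>+\<omega>. T \<omega> \<partial>M) = (\<integral>\<^sup>+\<omega>. hit (\<lambda>t. X t \<omega>) B \<partial>M)"
    by (rule nn_integral_cong_AE[OF eq])
  define E where "E = enn2real (\<integral>\<^sup>+\<omega>. T \<omega> \<partial>M)"
  have fin: "(\<integral>\<^sup>+\<omega>. T \<omega> \<partial>M) < \<infinity>"
    using nn_integral_hit(2) unfolding ET by (rule le_less_trans) simp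
  hence E: "(\<integral>\<^sup>+\<omega>. T \<omega> \<partial>M) = ennreal E" "E \<ge> 0" by (simp_all add: E_def)
  have "\<rho> * m' = (1 - \<epsilon>) / (1 + \<epsilon>) * m" using \<epsilon> by (simp add: power2_eq_square)
  moreover have "(1 - \<epsilon>) / (1 + \<epsilon>) * m \<le> E"
    using nn_integral_hit(1) E by (simp add: ET[symmetric])
  ultimately have E_ge: "\<rho> * m' \<le> E" by simp
  have E_le: "E \<le> m'" using nn_integral_hit(2) E m'_pos by (simp add: ET[symmetric] ennreal_le_iff)
  have \<rho>: "\<rho> > 0" using \<epsilon> by simp
  have E_pos: "E > 0" using E_ge mult_pos_pos[OF \<rho> m'_pos] by linarith
  have T_fin: "AE \<omega> in M. T \<omega> \<noteq> \<infinity>"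
    by (rule nn_integral_noteq_infinite[OF T]) (use fin in simp)
  have T_pos: "AE \<omega> in M. T \<omega> > 0"
    using eq start AE_space
  proof eventually_elim
    case (elim \<omega>)
    thus ?case using hit_pos[OF right_continuous, of \<omega> B] a_B by simp
  qed
  have meas: "(\<lambda>\<omega>. enn2real (T \<omega> / ennreal E)) \<in> borel_measurable M" using T by measurable
  have cdf_Y: "cdf Y x = prob {\<omega>\<in>space M. enn2real (T \<omega> / ennreal E) \<le> x}" for x
    unfolding cdf_def Y_def E(1) by (subst measure_distr[OF meas]) (auto intro!: arg_cong[where f = prob])
  have ratio: "T \<omega> = ennreal u \<Longrightarrow> u \<ge> 0 \<Longrightarrow> enn2real (T \<omega> / ennreal E) = u / E" for \<omega> u
    using E_pos by (simp add: divide_ennreal)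
  show "cdf Y x = 0" if x: "x \<le> 0"
  proof -
    have "AE \<omega> in M. \<not> enn2real (T \<omega> / ennreal E) \<le> x"
      using T_fin T_pos
    proof eventually_elim
      case (elim \<omega>)
      define u where "u = enn2real (T \<omega>)"
      have u: "T \<omega> = ennreal u" "u \<ge> 0" using elim by (auto simp: u_def less_top)
      have "u > 0" using elim(2) u by (simp add: ennreal_less_zero_iff)
      thus ?case using ratio[OF u] E_pos x by (simp add: not_le) (metis divide_pos_pos le_less_trans)
    qed
    moreover have "{\<omega>\<in>space M. enn2real (T \<omega> / ennreal E) \<le> x} \<in> events" using meas by measurable
    ultimately show ?thesis unfolding cdf_Y by (subst prob_Collect_eq_0)
  qed
  have tail: "cdf Y x = 1 - prob {\<omega>\<in>space M. ennreal (x * E) < hit (\<lambda>t. X t \<omega>) B}" if x: "x > 0"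
  proof -
    let ?A = "{\<omega>\<in>space M. ennreal (x * E) < T \<omega>}"
    have A: "?A \<in> events" using T by measurable
    have "cdf Y x = prob (space M - ?A)"
      unfolding cdf_Y
    proof (rule measure_eq_AE)
      show "AE \<omega> in M. \<omega> \<in> {\<omega>\<in>space M. enn2real (T \<omega> / ennreal E) \<le> x} \<longleftrightarrow> \<omega> \<in> space M - ?A"
        using T_fin
      proof eventually_elim
        case (elim \<omega>)
        define u where "u = enn2real (T \<omega>)"
        have u: "T \<omega> = ennreal u" "u \<ge> 0" using elim by (auto simp: u_def less_top)
        have "enn2real (T \<omega> / ennreal E) \<le> x \<longleftrightarrow> u \<le> x * E"
          using ratio[OF u] E_pos by (simp add: pos_divide_le_eq)
        also have "\<dots> \<longleftrightarrow> \<not> ennreal (x * E) < T \<omega>"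
          using u x E_pos by (auto simp: ennreal_less_iff not_less)
        finally show ?case by auto
      qed
      show "{\<omega>\<in>space M. enn2real (T \<omega> / ennreal E) \<le> x} \<in> events" using meas by measurable
      show "space M - ?A \<in> events" using A by auto
    qed
    also have "\<dots> = 1 - prob ?A" by (rule prob_compl[OF A])
    also have "prob ?A = prob {\<omega>\<in>space M. ennreal (x * E) < hit (\<lambda>t. X t \<omega>) B}"
    proof (rule measure_eq_AE)
      show "AE \<omega> in M. \<omega> \<in> ?A \<longleftrightarrow> \<omega> \<in> {\<omega>\<in>space M. ennreal (x * E) < hit (\<lambda>t. X t \<omega>) B}"
        using eq by eventually_elim auto
      show "{\<omega>\<in>space M. ennreal (x * E) < hit (\<lambda>t. X t \<omega>) B} \<in> events"
        using hit_measurable by measurable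
    qed (rule A)
    finally show ?thesis .
  qed
  show "cdf Y x \<le> 1 - exp (- x) + (1 - v)" if x: "x > 0"
  proof -
    have "x * E \<le> x * m'" using E_le x by (intro mult_left_mono) auto
    hence "x * E / m' \<le> x" using m'_pos by (simp only: pos_divide_le_eq)
    hence "- x \<le> - (x * E) / m'" by simp
    hence "exp (- x) \<le> exp (- (x * E) / m')" by (simp only: exp_le_cancel_iff)
    thus ?thesis using hit_tail_lower[OF mult_pos_pos[OF x E_pos]] tail[OF x] by linarith
  qed
  show "1 - (exp (- (real p * (x / real (Suc p)) * \<rho>)) + real (Suc p) * (1 - v) / (x * \<rho>)) \<le> cdf Y x"
    if x: "x > 0"
  proof -
    define \<tau> where "\<tau> = x * E / real (Suc p)"
    have \<tau>: "\<tau> > 0" using x E_pos by (simp add: \<tau>_def)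
    have "real (Suc p) * \<tau> = x * E" unfolding \<tau>_def by simp
    hence up: "prob {\<omega>\<in>space M. ennreal (x * E) < hit (\<lambda>t. X t \<omega>) B}
        \<le> exp (- (real p * \<tau>) / m') + m' * (1 - v) / \<tau>"
      using hit_tail_upper[OF \<tau>, of p] by simp
    have v: "0 \<le> 1 - v" using moment_ratio_le_1[OF \<epsilon>] by simp
    have \<tau>_ge: "x / real (Suc p) * \<rho> \<le> \<tau> / m'"
    proof -
      have "x / real (Suc p) * (\<rho> * m') \<le> x / real (Suc p) * E"
        using E_ge x by (intro mult_left_mono) auto
      hence "x / real (Suc p) * \<rho> * m' \<le> \<tau>"
        by (simp only: \<tau>_def mult.assoc times_divide_eq_left)
      thus ?thesis using m'_pos by (simp only: pos_le_divide_eq)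
    qed
    have "real p * (x / real (Suc p) * \<rho>) \<le> real p * (\<tau> / m')"
      using \<tau>_ge by (intro mult_left_mono) auto
    hence "exp (- (real p * \<tau>) / m') \<le> exp (- (real p * (x / real (Suc p)) * \<rho>))"
      by (simp add: mult.assoc)
    moreover have "m' * (1 - v) / \<tau> = (1 - v) / (\<tau> / m')" using m \<epsilon> \<tau> by (simp add: mult_ac)
    moreover have "(1 - v) / (\<tau> / m') \<le> (1 - v) / (x / real (Suc p) * \<rho>)"
    proof (rule divide_left_mono[OF \<tau>_ge v mult_pos_pos])
      show "0 < \<tau> / m'" by (rule divide_pos_pos[OF \<tau> m'_pos])
      show "0 < x / real (Suc p) * \<rho>" by (intro mult_pos_pos divide_pos_pos x \<rho>) simp
    qed
    moreover have "(1 - v) / (x / real (Suc p) * \<rho>) = real (Suc p) * (1 - v) / (x * \<rho>)"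
      by (simp add: mult_ac)
    ultimately show ?thesis using up tail[OF x] by linarith
  qed
qed

end

section \<open>Potentials for the bipartite graph\<close>

text \<open>The mean time from \<open>lo + n\<close> to \<open>lo + n + 1\<close> in a birth-and-death chain with birth rates \<open>r\<close>,
  death rates \<open>d\<close> and lowest state \<open>lo\<close>.\<close>
primrec climb_time :: "(int \<Rightarrow> real) \<Rightarrow> (int \<Rightarrow> real) \<Rightarrow> int \<Rightarrow> nat \<Rightarrow> real" where
  "climb_time r d lo 0 = 1 / r lo"
| "climb_time r d lo (Suc n) = (1 + d (lo + int (Suc n)) * climb_time r d lo n) / r (lo + int (Suc n))"

text \<open>The recursion is the first-step equation \<open>r i c i = 1 + d i c (i - 1)\<close>; it says that the sums
  \<open>f i = c i + \<dots> + c (b - 1)\<close> have \<open>Q f = - 1\<close> below \<open>b\<close>.\<close>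
lemma climb_times:
  fixes r d :: "int \<Rightarrow> real"
  assumes r: "\<And>i. lo \<le> i \<Longrightarrow> i < b \<Longrightarrow> r i > 0" and d: "\<And>i. lo \<le> i \<Longrightarrow> i < b \<Longrightarrow> d i \<ge> 0"
    and d_lo: "d lo = 0"
  obtains c where "\<And>i. lo \<le> i \<Longrightarrow> i < b \<Longrightarrow> c i > 0"
    and "\<And>i. lo \<le> i \<Longrightarrow> i < b \<Longrightarrow> r i * c i = 1 + d i * c (i - 1)"
proof
  define c where "c i = climb_time r d lo (nat (i - lo))" for i
  have pos: "climb_time r d lo n > 0" if "lo + int n < b" for n
    using that
  proof (induction n)
    case 0
    thus ?case using r[of lo] by simp
  next
    case (Suc n)
    hence "climb_time r d lo n > 0" by simp
    moreover have "r (lo + int (Suc n)) > 0" "d (lo + int (Suc n)) \<ge> 0" using Suc.prems by (auto intro!: r d)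
    ultimately show ?case unfolding climb_time.simps
      by (intro divide_pos_pos add_pos_nonneg mult_nonneg_nonneg) auto
  qed
  fix i assume i: "lo \<le> i" "i < b"
  show "c i > 0" using pos[of "nat (i - lo)"] i by (simp add: c_def)
  show "r i * c i = 1 + d i * c (i - 1)"
  proof (cases "i = lo")
    case True
    thus ?thesis using r[of lo] i d_lo by (simp add: c_def)
  next
    case False
    then obtain n where n: "i = lo + int (Suc n)"
      using i by (metis zle_iff_zadd add.right_neutral of_nat_0 not0_implies_Suc)
    have "c i = climb_time r d lo (Suc n)" "c (i - 1) = climb_time r d lo n"
      by (simp_all add: c_def n nat_add_distrib)
    thus ?thesis using r[OF i] unfolding climb_time.simps n by (simp del: of_nat_Suc)
  qed
qed

lemma generator_bipartite:
  assumes "L\<^sub>1 \<ge> 0" "- L\<^sub>1 \<le> i" "i < L\<^sub>2"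
  shows "generator {- L\<^sub>1..L\<^sub>2} (bipartite_rate L\<^sub>1 L\<^sub>2 \<nu>) g i =
    bipartite_rate L\<^sub>1 L\<^sub>2 \<nu> i (i + 1) * (g (i + 1) - g i) +
    bipartite_rate L\<^sub>1 L\<^sub>2 \<nu> i (i - 1) * (g (i - 1) - g i)"
proof -
  have "generator {- L\<^sub>1..L\<^sub>2} (bipartite_rate L\<^sub>1 L\<^sub>2 \<nu>) g i
      = (\<Sum>j\<in>{i + 1, i - 1}. bipartite_rate L\<^sub>1 L\<^sub>2 \<nu> i j * (g j - g i))"
    unfolding generator_def using assms
    by (intro sum.mono_neutral_cong) (auto simp: bipartite_rate_def)
  thus ?thesis by simp
qed

text \<open>The well consists of the negative states. At \<open>- L\<^sub>1 < i < 0\<close> the deaths have rate at least \<open>\<nu>\<close> and the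
  births rate at most \<open>L\<^sub>1\<close>, so the recursion forces \<open>c (i - 1) \<le> (L\<^sub>1 / \<nu>) c i\<close>: climbing from the
  bottom of the well to \<open>- 1\<close> is negligible against the last step, whence \<open>f\<close> is almost
  constant there. On the nonnegative states the upward rate is at least \<open>\<nu>\<close>, so a
  function of slope \<open>- 2 / \<nu>\<close> decreases at rate at least \<open>1\<close> as soon as \<open>\<nu> \<ge> 2 L\<^sub>2\<close>; it is
  constant on the well.
  Its value \<open>2 l\<^sub>2 / \<nu>\<close> at the start is small against \<open>m \<ge> 1\<close>.\<close>
lemma bipartite_metastable:
  fixes L\<^sub>1 L\<^sub>2 l\<^sub>1 l\<^sub>2 :: int and \<nu> :: real
  assumes L: "L\<^sub>1 \<ge> 1" "L\<^sub>2 \<ge> 1" and l1: "0 < l\<^sub>1" "l\<^sub>1 \<le> L\<^sub>1" and l2: "0 < l\<^sub>2" "l\<^sub>2 \<le> L\<^sub>2"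
    and \<nu>: "\<nu> > of_int (L\<^sub>1^2 + 2 * L\<^sub>2)"
    and chain: "killed_chain M {- L\<^sub>1..L\<^sub>2} (bipartite_rate L\<^sub>1 L\<^sub>2 \<nu>) X (- l\<^sub>1) P {l\<^sub>2..}"
  obtains f h m where "metastable_chain M {- L\<^sub>1..L\<^sub>2} (bipartite_rate L\<^sub>1 L\<^sub>2 \<nu>) X (- l\<^sub>1) P {l\<^sub>2..}
    f h {0..} m (of_int (L\<^sub>1^2 + 2 * L\<^sub>2) / \<nu>)"
proof -
  define \<epsilon> where "\<epsilon> = of_int (L\<^sub>1^2 + 2 * L\<^sub>2) / \<nu>"
  define r where "r i = bipartite_rate L\<^sub>1 L\<^sub>2 \<nu> i (i + 1)" for i
  define d where "d i = bipartite_rate L\<^sub>1 L\<^sub>2 \<nu> i (i - 1)" for i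
  have L1sq: "L\<^sub>1 \<le> L\<^sub>1^2" using L by (simp add: self_le_power)
  have C_pos: "(0::real) < of_int (L\<^sub>1^2 + 2 * L\<^sub>2)"
    unfolding of_int_0_less_iff using L L1sq by linarith
  have \<nu>pos: "\<nu> > 0" using \<nu> C_pos by linarith
  have \<nu>L1: "of_int L\<^sub>1 \<le> \<nu>"
  proof -
    have "L\<^sub>1 \<le> L\<^sub>1^2 + 2 * L\<^sub>2" using L L1sq by linarith
    hence "(of_int L\<^sub>1 :: real) \<le> of_int (L\<^sub>1^2 + 2 * L\<^sub>2)" by (simp only: of_int_le_iff)
    thus ?thesis using \<nu> by linarith
  qed
  have \<nu>L2: "2 * of_int L\<^sub>2 \<le> \<nu>"
  proof -
    have "0 \<le> (real_of_int L\<^sub>1)^2" by simp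
    moreover have "(real_of_int L\<^sub>1)^2 + 2 * of_int L\<^sub>2 < \<nu>" using \<nu> by simp
    ultimately show ?thesis by linarith
  qed
  have \<epsilon>: "0 < \<epsilon>" "\<epsilon> < 1" using C_pos \<nu>pos \<nu> by (simp_all add: \<epsilon>_def)
  have r_neg: "r i = of_int (- i)" if "- L\<^sub>1 \<le> i" "i < 0" for i
    using that by (simp add: r_def bipartite_rate_def)
  have r_pos: "r i = of_int (L\<^sub>2 - i) * \<nu>" if "0 \<le> i" "i < L\<^sub>2" for i
    using that by (simp add: r_def bipartite_rate_def)
  have d_neg: "d i = of_int (L\<^sub>1 + i) * \<nu>" if "- L\<^sub>1 < i" "i \<le> 0" for i
    using that by (simp add: d_def bipartite_rate_def)
  have d_pos: "d i = of_int i" if "0 < i" "i \<le> L\<^sub>2" for i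
    using that by (simp add: d_def bipartite_rate_def)
  have d_lo: "d (- L\<^sub>1) = 0" using L by (simp add: d_def bipartite_rate_def)
  have r_gt: "r i > 0" if "- L\<^sub>1 \<le> i" "i < l\<^sub>2" for i
    using r_neg[of i] r_pos[of i] that l2 \<nu>pos by (cases "i < 0") auto
  have d_ge: "d i \<ge> 0" if "- L\<^sub>1 \<le> i" "i < l\<^sub>2" for i
    using d_neg[of i] d_pos[of i] d_lo that l2 \<nu>pos by (cases "i = - L\<^sub>1"; cases "i \<le> 0") auto
  obtain c where c_pos: "\<And>i. - L\<^sub>1 \<le> i \<Longrightarrow> i < l\<^sub>2 \<Longrightarrow> c i > 0"
    and c_rec: "\<And>i. - L\<^sub>1 \<le> i \<Longrightarrow> i < l\<^sub>2 \<Longrightarrow> r i * c i = 1 + d i * c (i - 1)"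
    using climb_times[where lo = "- L\<^sub>1" and b = l\<^sub>2 and r = r and d = d, OF r_gt d_ge d_lo] by blast
  have c_nonneg: "c i \<ge> 0" if "- L\<^sub>1 \<le> i" "i < l\<^sub>2" for i
    using c_pos[OF that] by simp
  define f where "f i = (\<Sum>k\<in>{i..<l\<^sub>2}. c k)" for i
  define m where "m = f (- L\<^sub>1)"
  define h where "h i = 2 * of_int (max 0 (l\<^sub>2 - max i 0)) / \<nu>" for i :: int
  have f_rec: "f i = c i + f (i + 1)" if "i < l\<^sub>2" for i
  proof -
    have "{i..<l\<^sub>2} = insert i {i + 1..<l\<^sub>2}" using that by auto
    thus ?thesis by (simp add: f_def)
  qed
  have split: "m = (\<Sum>k\<in>{- L\<^sub>1..<i}. c k) + f i" if "- L\<^sub>1 \<le> i" "i \<le> l\<^sub>2" for i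
  proof -
    have "{- L\<^sub>1..<l\<^sub>2} = {- L\<^sub>1..<i} \<union> {i..<l\<^sub>2}" using that by auto
    moreover have "sum c ({- L\<^sub>1..<i} \<union> {i..<l\<^sub>2}) = sum c {- L\<^sub>1..<i} + sum c {i..<l\<^sub>2}"
      by (rule sum.union_disjoint) auto
    ultimately show ?thesis by (simp add: m_def f_def)
  qed
  have f_nonneg: "f i \<ge> 0" if "- L\<^sub>1 \<le> i" for i
    unfolding f_def using that by (intro sum_nonneg c_nonneg) auto
  have f_top: "f i = 0" if "l\<^sub>2 \<le> i" for i using that by (simp add: f_def)
  have f_le: "f i \<le> m" if "- L\<^sub>1 \<le> i" for i
  proof (cases "i \<le> l\<^sub>2")
    case True
    have "(\<Sum>k\<in>{- L\<^sub>1..<i}. c k) \<ge> 0" using True by (intro sum_nonneg c_nonneg) auto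
    thus ?thesis using split[OF that True] by simp
  next
    case False
    thus ?thesis using f_top f_nonneg[of "- L\<^sub>1"] by (simp add: m_def)
  qed
  \<comment> \<open>The birth rate at \<open>- 1\<close> is \<open>1\<close>, which keeps the mean away from \<open>0\<close> uniformly in \<open>\<nu>\<close>.\<close>
  have c_m1: "1 \<le> c (- 1)"
  proof -
    have "r (- 1) = 1" using L by (simp add: r_neg)
    hence "c (- 1) = 1 + d (- 1) * c (- 2)" using c_rec[of "- 1"] L l2 by simp
    moreover have "d (- 1) * c (- 2) \<ge> 0"
      using d_lo d_ge[of "- 1"] c_nonneg[of "- 2"] L l2 by (cases "L\<^sub>1 = 1") auto
    ultimately show ?thesis by simp
  qed
  have c_m1_le: "c (- 1) \<le> m"
  proof -
    have "c (- 1) \<le> f (- 1)" using f_rec[of "- 1"] f_nonneg[of 0] l2 L by simp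
    thus ?thesis using f_le[of "- 1"] L by simp
  qed
  have m_ge: "1 \<le> m" using c_m1 c_m1_le by simp
  have c_ratio: "c (i - 1) \<le> of_int L\<^sub>1 / \<nu> * c i" if "- L\<^sub>1 < i" "i < 0" for i
  proof -
    have ci: "c i > 0" "c (i - 1) > 0" using that l2 by (auto intro!: c_pos)
    have "\<nu> * c (i - 1) \<le> d i * c (i - 1)"
    proof (rule mult_right_mono)
      have "1 \<le> L\<^sub>1 + i" using that by simp
      hence "(1::real) \<le> of_int (L\<^sub>1 + i)" by (simp only: of_int_1_le_iff)
      thus "\<nu> \<le> d i" using mult_right_mono[of 1 "of_int (L\<^sub>1 + i)" \<nu>] \<nu>pos that by (simp only: d_neg) auto
    qed (use ci in simp)
    also have "\<dots> \<le> r i * c i" using c_rec[of i] that l2 by simp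
    also have "\<dots> \<le> of_int L\<^sub>1 * c i"
      using that ci by (intro mult_right_mono) (auto simp: r_neg)
    finally show ?thesis using \<nu>pos by (simp add: field_simps)
  qed
  \<comment> \<open>Indices run downwards from \<open>- 2\<close>; the factor \<open>L\<^sub>1 / \<nu> \<le> 1\<close> is kept only once.\<close>
  have c_small: "c (- 2 - int n) \<le> of_int L\<^sub>1 / \<nu> * c (- 1)" if "- L\<^sub>1 \<le> - 2 - int n" for n
    using that
  proof (induction n)
    case 0
    thus ?case using c_ratio[of "- 1"] by simp
  next
    case (Suc n)
    have "c (- 2 - int (Suc n)) \<le> of_int L\<^sub>1 / \<nu> * c (- 2 - int n)"
      using c_ratio[of "- 2 - int n"] Suc.prems by (simp add: algebra_simps)
    also have "\<dots> \<le> 1 * c (- 2 - int n)"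
      using \<nu>L1 \<nu>pos c_pos[of "- 2 - int n"] Suc.prems l2 by (intro mult_right_mono) auto
    also have "\<dots> \<le> of_int L\<^sub>1 / \<nu> * c (- 1)" using Suc by simp
    finally show ?case .
  qed
  have f_large: "(1 - \<epsilon>) * m \<le> f i" if "- L\<^sub>1 \<le> i" "i < 0" for i
  proof -
    have "(\<Sum>k\<in>{- L\<^sub>1..<i}. c k) \<le> (\<Sum>k\<in>{- L\<^sub>1..<i}. of_int L\<^sub>1 / \<nu> * m)"
    proof (rule sum_mono)
      fix k assume k: "k \<in> {- L\<^sub>1..<i}"
      have "k = - 2 - int (nat (- 2 - k))" using k that by simp
      hence "c k \<le> of_int L\<^sub>1 / \<nu> * c (- 1)" using c_small[of "nat (- 2 - k)"] k by simp
      also have "\<dots> \<le> of_int L\<^sub>1 / \<nu> * m" using c_m1_le L \<nu>pos by (intro mult_left_mono) auto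
      finally show "c k \<le> of_int L\<^sub>1 / \<nu> * m" .
    qed
    also have "\<dots> = of_int (i + L\<^sub>1) * (of_int L\<^sub>1 / \<nu> * m)" using that by simp
    also have "\<dots> \<le> of_int L\<^sub>1 * (of_int L\<^sub>1 / \<nu> * m)"
      using that m_ge L \<nu>pos by (intro mult_right_mono) auto
    also have "\<dots> = of_int (L\<^sub>1^2) / \<nu> * m" by (simp add: power2_eq_square)
    also have "\<dots> \<le> \<epsilon> * m"
      unfolding \<epsilon>_def using L m_ge \<nu>pos by (intro mult_right_mono divide_right_mono) auto
    finally show ?thesis using split[of i] that l2 by (simp add: algebra_simps)
  qed
  have gen: "generator {- L\<^sub>1..L\<^sub>2} (bipartite_rate L\<^sub>1 L\<^sub>2 \<nu>) g i
      = r i * (g (i + 1) - g i) + d i * (g (i - 1) - g i)" if "- L\<^sub>1 \<le> i" "i < l\<^sub>2" for g i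
    unfolding r_def d_def using that l2 L by (intro generator_bipartite) auto
  have f_gen: "generator {- L\<^sub>1..L\<^sub>2} (bipartite_rate L\<^sub>1 L\<^sub>2 \<nu>) f i = - 1" if i: "- L\<^sub>1 \<le> i" "i < l\<^sub>2" for i
  proof -
    have "r i * (f (i + 1) - f i) = - (r i * c i)" using f_rec[of i] i by simp
    moreover have "d i * (f (i - 1) - f i) = d i * c (i - 1)" using f_rec[of "i - 1"] i by simp
    ultimately show ?thesis using gen[OF i, of f] c_rec[OF i] by simp
  qed
  have h_gen: "generator {- L\<^sub>1..L\<^sub>2} (bipartite_rate L\<^sub>1 L\<^sub>2 \<nu>) h i \<le> - of_bool (i \<in> {0..})"
    if i: "- L\<^sub>1 \<le> i" "i < l\<^sub>2" for i
  proof (cases i "0::int" rule: linorder_cases)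
    case less
    hence "h (i + 1) = h i" "h (i - 1) = h i" by (simp_all add: h_def)
    thus ?thesis using gen[OF i, of h] less by simp
  next
    case equal
    have "h 1 - h 0 = - (2 / \<nu>)" "h (- 1) - h 0 = 0"
      using l2 by (simp_all add: h_def diff_divide_distrib[symmetric])
    hence "generator {- L\<^sub>1..L\<^sub>2} (bipartite_rate L\<^sub>1 L\<^sub>2 \<nu>) h i = - (2 * of_int L\<^sub>2)"
      using gen[OF i, of h] equal r_pos[of 0] \<nu>pos L by simp
    also have "\<dots> \<le> - 1" using L by simp
    finally show ?thesis using equal by simp
  next
    case greater
    have h: "h (i + 1) - h i = - (2 / \<nu>)" "h (i - 1) - h i = 2 / \<nu>"
      using i greater by (simp_all add: h_def diff_divide_distrib[symmetric])
    have "(1::real) \<le> of_int (L\<^sub>2 - i)" unfolding of_int_1_le_iff using i l2 by simp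
    hence "1 * \<nu> \<le> r i" using r_pos[of i] i greater l2 \<nu>pos by (simp only: mult_right_mono)
    hence "r i * (2 / \<nu>) \<ge> 2" using \<nu>pos by (simp add: field_simps)
    moreover have "d i * (2 / \<nu>) \<le> 1"
    proof -
      have "2 * d i \<le> 2 * of_int L\<^sub>2" using d_pos[of i] i greater l2 by simp
      also have "\<dots> \<le> \<nu>" by (rule \<nu>L2)
      finally show ?thesis using \<nu>pos by (simp add: field_simps)
    qed
    ultimately show ?thesis using gen[OF i, of h] greater unfolding h by simp
  qed
  have h_start: "h (- l\<^sub>1) \<le> \<epsilon> * m"
  proof -
    have "h (- l\<^sub>1) = of_int (2 * l\<^sub>2) / \<nu>" using l1 l2 by (simp add: h_def)
    also have "\<dots> \<le> \<epsilon>"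
    proof -
      have "2 * l\<^sub>2 \<le> L\<^sub>1^2 + 2 * L\<^sub>2" using l2 zero_le_power2[of L\<^sub>1] by linarith
      hence "(of_int (2 * l\<^sub>2) :: real) \<le> of_int (L\<^sub>1^2 + 2 * L\<^sub>2)" by (simp only: of_int_le_iff)
      thus ?thesis unfolding \<epsilon>_def using \<nu>pos by (intro divide_right_mono) auto
    qed
    also have "\<dots> \<le> \<epsilon> * m" using \<epsilon> m_ge by simp
    finally show ?thesis .
  qed
  interpret killed_chain M "{- L\<^sub>1..L\<^sub>2}" "bipartite_rate L\<^sub>1 L\<^sub>2 \<nu>" X "- l\<^sub>1" P "{l\<^sub>2..}" by (rule chain)
  have "metastable_chain M {- L\<^sub>1..L\<^sub>2} (bipartite_rate L\<^sub>1 L\<^sub>2 \<nu>) X (- l\<^sub>1) P {l\<^sub>2..} f h {0..} m \<epsilon>"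
  proof unfold_locales
    show "0 < \<epsilon>" "\<epsilon> < 1" "m > 0" using \<epsilon> m_ge by auto
    show "(1 - \<epsilon>) * m \<le> f (- l\<^sub>1)" using l1 by (intro f_large) auto
    show "h (- l\<^sub>1) \<le> \<epsilon> * m" by (rule h_start)
    show "0 \<le> h i" for i using \<nu>pos by (simp add: h_def)
    show "generator {- L\<^sub>1..L\<^sub>2} (bipartite_rate L\<^sub>1 L\<^sub>2 \<nu>) h i \<le> - of_bool (i \<in> {0..})"
      if "i \<in> {- L\<^sub>1..L\<^sub>2}" "i \<notin> {l\<^sub>2..}" for i
      by (rule h_gen) (use that in auto)
  qed (auto simp: h_def not_le intro: f_nonneg f_le f_top f_gen f_large)
  thus thesis unfolding \<epsilon>_def by (rule that)
qed

section \<open>Convergence to the exponential distribution\<close>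
lemma cdf_Exp_distr_1: "cdf (Exp_distr 1) x = (if x \<le> 0 then 0 else 1 - exp (- x))"
proof -
  interpret E: prob_space "Exp_distr 1"
    unfolding Exp_distr_def by (rule prob_space_exponential_density) simp
  have sets_E: "sets (Exp_distr 1) = sets borel" and space_E: "space (Exp_distr 1) = UNIV"
    by (simp_all add: Exp_distr_def)
  have "distr (Exp_distr 1) lborel (\<lambda>x. x) = Exp_distr 1"
    by (rule distr_id2) (simp add: sets_E)
  hence D: "distributed (Exp_distr 1) lborel (\<lambda>x. x) (exponential_density 1)"
    unfolding distributed_def by (auto simp: Exp_distr_def intro!: measurableI)
  have le: "cdf (Exp_distr 1) y = 1 - exp (- y)" if "y \<ge> 0" for y
    using E.exponential_distributedD_le[OF D that] by (simp add: cdf_def space_E atMost_def)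
  show ?thesis
  proof (cases "x \<le> 0")
    case True
    hence "cdf (Exp_distr 1) x \<le> cdf (Exp_distr 1) 0"
      unfolding cdf_def by (intro E.finite_measure_mono) (auto simp: sets_E)
    also have "\<dots> = 0" using le[of 0] by simp
    finally show ?thesis using True by (simp add: cdf_def measure_le_0_iff)
  qed (use le in simp)
qed

lemma bipartite_cdf_bounds:
  fixes L\<^sub>1 L\<^sub>2 l\<^sub>1 l\<^sub>2 :: int and \<nu> :: real
  assumes L: "L\<^sub>1 \<ge> 1" "L\<^sub>2 \<ge> 1" and l1: "0 < l\<^sub>1" "l\<^sub>1 \<le> L\<^sub>1" and l2: "0 < l\<^sub>2" "l\<^sub>2 \<le> L\<^sub>2"
    and \<nu>: "\<nu> > of_int (L\<^sub>1^2 + 2 * L\<^sub>2)"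
    and chain: "markov_chain M {- L\<^sub>1..L\<^sub>2} (bipartite_rate L\<^sub>1 L\<^sub>2 \<nu>) X (- l\<^sub>1)"
  defines "T \<equiv> first_passage_time X l\<^sub>2"
  defines "Y \<equiv> distr M borel (\<lambda>\<omega>. enn2real (T \<omega> / (\<integral>\<^sup>+\<omega>'. T \<omega>' \<partial>M)))"
  defines "\<epsilon> \<equiv> of_int (L\<^sub>1^2 + 2 * L\<^sub>2) / \<nu>"
  shows "x \<le> 0 \<Longrightarrow> cdf Y x = 0"
    and "x > 0 \<Longrightarrow> cdf Y x \<le> 1 - exp (- x) + (1 - moment_ratio \<epsilon>)"
    and "x > 0 \<Longrightarrow> 1 - (exp (- (real p * (x / real (Suc p)) * ((1 - \<epsilon>)^2 / (1 + \<epsilon>)))) +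
           real (Suc p) * (1 - moment_ratio \<epsilon>) / (x * ((1 - \<epsilon>)^2 / (1 + \<epsilon>)))) \<le> cdf Y x"
proof -
  interpret markov_chain M "{- L\<^sub>1..L\<^sub>2}" "bipartite_rate L\<^sub>1 L\<^sub>2 \<nu>" X "- l\<^sub>1" by (rule chain)
  obtain P where P: "transition_function {- L\<^sub>1..L\<^sub>2} (bipartite_rate L\<^sub>1 L\<^sub>2 \<nu>) P"
    and P_markov: "\<forall>s\<ge>0. \<forall>t\<ge>0. \<forall>A\<in>sets (past M X s). \<forall>i\<in>{- L\<^sub>1..L\<^sub>2}. \<forall>j\<in>{- L\<^sub>1..L\<^sub>2}.
      prob {\<omega>\<in>A. X s \<omega> = i \<and> X (s + t) \<omega> = j} = prob {\<omega>\<in>A. X s \<omega> = i} * P t i j"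
    using markov by blast
  have killed: "killed_chain M {- L\<^sub>1..L\<^sub>2} (bipartite_rate L\<^sub>1 L\<^sub>2 \<nu>) X (- l\<^sub>1) P B" if "- l\<^sub>1 \<notin> B" for B
    using P P_markov that by unfold_locales blast+
  interpret up: killed_chain M "{- L\<^sub>1..L\<^sub>2}" "bipartite_rate L\<^sub>1 L\<^sub>2 \<nu>" X "- l\<^sub>1" P "{l\<^sub>2..}"
    using l1 l2 by (intro killed) auto
  interpret single: killed_chain M "{- L\<^sub>1..L\<^sub>2}" "bipartite_rate L\<^sub>1 L\<^sub>2 \<nu>" X "- l\<^sub>1" P "{l\<^sub>2}"
    using l1 l2 by (intro killed) auto
  obtain f h m where "metastable_chain M {- L\<^sub>1..L\<^sub>2} (bipartite_rate L\<^sub>1 L\<^sub>2 \<nu>) X (- l\<^sub>1) P {l\<^sub>2..} f h {0..} m \<epsilon>"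
    unfolding \<epsilon>_def by (rule bipartite_metastable[OF L l1 l2 \<nu> up.killed_chain_axioms])
  then interpret metastable_chain M "{- L\<^sub>1..L\<^sub>2}" "bipartite_rate L\<^sub>1 L\<^sub>2 \<nu>" X "- l\<^sub>1" P "{l\<^sub>2..}" f h "{0..}" m \<epsilon> .
  have T: "T = (\<lambda>\<omega>. hit (\<lambda>t. X t \<omega>) {l\<^sub>2})"
    by (simp add: T_def fun_eq_iff first_passage_time_eq_hit)
  have meas: "T \<in> borel_measurable M" unfolding T by (rule single.hit_measurable)
  have "AE \<omega> in M. hit (\<lambda>t. X t \<omega>) {l\<^sub>2..} = hit (\<lambda>t. X t \<omega>) {l\<^sub>2}"
    by (rule up.AE_no_skip) (auto simp: bipartite_rate_def)
  hence eq: "AE \<omega> in M. T \<omega> = hit (\<lambda>t. X t \<omega>) {l\<^sub>2..}" unfolding T by eventually_elim simp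
  note bounds = normalised_hit_cdf[OF meas eq, folded Y_def]
  show "x \<le> 0 \<Longrightarrow> cdf Y x = 0"
    and "x > 0 \<Longrightarrow> cdf Y x \<le> 1 - exp (- x) + (1 - moment_ratio \<epsilon>)"
    and "x > 0 \<Longrightarrow> 1 - (exp (- (real p * (x / real (Suc p)) * ((1 - \<epsilon>)^2 / (1 + \<epsilon>)))) +
           real (Suc p) * (1 - moment_ratio \<epsilon>) / (x * ((1 - \<epsilon>)^2 / (1 + \<epsilon>)))) \<le> cdf Y x"
    by (fact bounds)+
qed

theorem mainTheorem2:
  fixes L\<^sub>1 L\<^sub>2 l\<^sub>1 l\<^sub>2 :: int
    and M :: "real \<Rightarrow> 'a measure"
    and X :: "real \<Rightarrow> real \<Rightarrow> 'a \<Rightarrow> int"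
  assumes "L\<^sub>1 \<ge> 1" and "L\<^sub>2 \<ge> 1"
    and "0 < l\<^sub>1" and "l\<^sub>1 \<le> L\<^sub>1"
    and "0 < l\<^sub>2" and "l\<^sub>2 \<le> L\<^sub>2"
    and "\<And>\<nu>. \<nu> > 0 \<Longrightarrow>
      markov_chain (M \<nu>) {- L\<^sub>1..L\<^sub>2} (bipartite_rate L\<^sub>1 L\<^sub>2 \<nu>) (X \<nu>) (- l\<^sub>1)"
  defines "T \<equiv> \<lambda>\<nu>. first_passage_time (X \<nu>) l\<^sub>2"
  shows "weak_conv_filter
    (\<lambda>\<nu>. distr (M \<nu>) borel (\<lambda>\<omega>. enn2real (T \<nu> \<omega> / (\<integral>\<^sup>+\<omega>'. T \<nu> \<omega>' \<partial>M \<nu>))))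
    (Exp_distr 1) at_top"
proof -
  define Y where "Y \<nu> = distr (M \<nu>) borel (\<lambda>\<omega>. enn2real (T \<nu> \<omega> / (\<integral>\<^sup>+\<omega>'. T \<nu> \<omega>' \<partial>M \<nu>)))" for \<nu>
  define C :: real where "C = of_int (L\<^sub>1^2 + 2 * L\<^sub>2)"
  have "C > 0"
    unfolding C_def of_int_0_less_iff using assms(2) zero_le_power2[of L\<^sub>1] by linarith
  hence bounds:
    "x \<le> 0 \<Longrightarrow> cdf (Y \<nu>) x = 0"
    "x > 0 \<Longrightarrow> cdf (Y \<nu>) x \<le> 1 - exp (- x) + (1 - moment_ratio (C / \<nu>))"
    "x > 0 \<Longrightarrow> 1 - (exp (- (real p * (x / real (Suc p)) * ((1 - C / \<nu>)^2 / (1 + C / \<nu>)))) +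
       real (Suc p) * (1 - moment_ratio (C / \<nu>)) / (x * ((1 - C / \<nu>)^2 / (1 + C / \<nu>)))) \<le> cdf (Y \<nu>) x"
    if "\<nu> > C" for \<nu> x p
    using bipartite_cdf_bounds[OF assms(1-6) _ assms(7), of \<nu>] that unfolding Y_def T_def C_def by auto
  have \<epsilon>_lim: "((\<lambda>\<nu>. C / \<nu>) \<longlongrightarrow> 0) at_top"
    by (intro tendsto_divide_0[OF tendsto_const] filterlim_at_top_imp_at_infinity filterlim_ident)
  have v_lim: "((\<lambda>\<nu>. moment_ratio (C / \<nu>)) \<longlongrightarrow> 1) at_top"
    unfolding moment_ratio_def by (rule tendsto_eq_intros \<epsilon>_lim refl | simp)+
  have \<rho>_lim: "((\<lambda>\<nu>. (1 - C / \<nu>)^2 / (1 + C / \<nu>)) \<longlongrightarrow> 1) at_top"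
    by (rule tendsto_eq_intros \<epsilon>_lim refl | simp)+
  have large: "\<forall>\<^sub>F \<nu> in at_top. \<nu> > C" by (rule eventually_gt_at_top)
  have "((\<lambda>\<nu>. cdf (Y \<nu>) x) \<longlongrightarrow> cdf (Exp_distr 1) x) at_top" for x
  proof (cases "x \<le> 0")
    case True
    have "\<forall>\<^sub>F \<nu> in at_top. cdf (Y \<nu>) x = 0"
      using large by eventually_elim (use bounds(1) True in blast)
    thus ?thesis using True by (simp add: cdf_Exp_distr_1 tendsto_eventually)
  next
    case False
    hence x: "x > 0" by simp
    have "((\<lambda>\<nu>. cdf (Y \<nu>) x) \<longlongrightarrow> 1 - exp (- x)) at_top"
    proof (rule order_tendstoI)
      fix a assume a: "a < 1 - exp (- x)"
      have "(\<lambda>p. real p / real (Suc p)) \<longlonglongrightarrow> 1" by (rule LIMSEQ_n_over_Suc_n)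
      hence "(\<lambda>p. 1 - exp (- (real p / real (Suc p) * x))) \<longlonglongrightarrow> 1 - exp (- (1 * x))"
        by (intro tendsto_intros)
      hence "\<forall>\<^sub>F p in sequentially. a < 1 - exp (- (real p / real (Suc p) * x))"
        using a by (intro order_tendstoD) auto
      \<comment> \<open>Fix \<open>p\<close> with the limiting lower bound above \<open>a\<close>, and only then let \<open>\<nu>\<close> grow.\<close>
      then obtain p where p: "a < 1 - exp (- (real p / real (Suc p) * x))"
        by (auto dest: eventually_happens)
      have "((\<lambda>\<nu>. 1 - (exp (- (real p * (x / real (Suc p)) * ((1 - C / \<nu>)^2 / (1 + C / \<nu>)))) +
          real (Suc p) * (1 - moment_ratio (C / \<nu>)) / (x * ((1 - C / \<nu>)^2 / (1 + C / \<nu>))))) \<longlongrightarrow>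
        1 - (exp (- (real p * (x / real (Suc p)) * 1)) + real (Suc p) * (1 - 1) / (x * 1))) at_top"
        using x by (intro tendsto_intros v_lim \<rho>_lim) auto
      hence "\<forall>\<^sub>F \<nu> in at_top. a < 1 - (exp (- (real p * (x / real (Suc p)) * ((1 - C / \<nu>)^2 / (1 + C / \<nu>)))) +
          real (Suc p) * (1 - moment_ratio (C / \<nu>)) / (x * ((1 - C / \<nu>)^2 / (1 + C / \<nu>))))"
        using p by (intro order_tendstoD(1)) auto
      with large show "\<forall>\<^sub>F \<nu> in at_top. a < cdf (Y \<nu>) x"
        by eventually_elim (use bounds(3)[OF _ x] less_le_trans in blast)
    next
      fix a assume a: "1 - exp (- x) < a"
      have "((\<lambda>\<nu>. 1 - exp (- x) + (1 - moment_ratio (C / \<nu>))) \<longlongrightarrow> 1 - exp (- x) + (1 - 1)) at_top"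
        by (intro tendsto_intros v_lim)
      hence "\<forall>\<^sub>F \<nu> in at_top. 1 - exp (- x) + (1 - moment_ratio (C / \<nu>)) < a"
        using a by (intro order_tendstoD(2)) auto
      with large show "\<forall>\<^sub>F \<nu> in at_top. cdf (Y \<nu>) x < a"
        by eventually_elim (use bounds(2)[OF _ x] le_less_trans in blast)
    qed
    thus ?thesis using x by (simp add: cdf_Exp_distr_1)
  qed
  thus ?thesis unfolding weak_conv_filter_def Y_def by blast
qed

end
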